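(* Let $\rho>0$, $\eta>0$, $\eta\ne1$. A liquidity provider (LP) solves $$V(w)=\sup_{\{\theta_t\}}\ \mathbb E\Big[\int_0^\infty e^{-\rho t}\frac{W_t^{1-\eta}}{1-\eta}\,dt\ \Big|\ W_0=w\Big],\qquad\theta_t\in[\theta_{\min},\theta_{\max}],$$ subject to the wealth dynamics $$dW_t=(A^{out}_t+R_{A,t-})\,dP_t-r_t^{*}D_t\,dt+\dot F_t^{N}\,dt+\Delta W_t^-\,dN_t^-+\Delta W_t^+\,dN_t^+,\qquad \Delta W_t^\pm=V^{\mathrm{AMM}}_{t-}(P_t)\,J_{\mathrm{ext}}^\pm(M^\pm,U^\pm;\gamma).$$ Assume that the controlled wealth can be written in the proportional form $$\frac{dW_t}{W_{t-}}=\big(\mu-r^*\theta_t+\theta_t\psi^N_t\big)dt+\sqrt{v_t}\,dB_t+\theta_tJ^-_{\mathrm{ext}}(M^-,U^-(\theta_t,v_t);\gamma)\,dN^-_t+\theta_tJ^+_{\mathrm{ext}}(M^+,U^+(\theta_t,v_t);\gamma)\,dN^+_t,$$ where $U^\pm(\theta,v)$ captures that arbitrageur overrun scales with pool depth and outside volatility, because $\theta$ determines the pool invariant $K$. Define the admissible set $$\Theta_{\mathrm{adm}}=\{\theta\in[\theta_{\min},\theta_{\max}]:1+\theta J^{-}_{\mathrm{ext}}(M^-,U^-(\theta,v_t);\gamma)>0\ \text{a.s.},\ 1+\theta J^{+}_{\mathrm{ext}}(M^+,U^+(\theta,v_t);\gamma)>0\ \text{a.s.}\}.$$ Then, conditional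 on $\mathcal F_{t-}$, the maximization in the CRRA Hamilton–Jacobi–Bellman equation of this problem reduces pointwise in $\theta$ to maximizing $$\Phi_t(\theta):=\mu-r^*\theta-\frac\eta2v_t+\theta\psi_t^N+\sum_\pm\frac{\lambda_t^\pm(\theta,v_t)}{1-\eta}\,\mathbb E\big[(1+\theta J^\pm_{\mathrm{ext}}(M^\pm,U^\pm(\theta,v_t);\gamma))^{1-\eta}-1\ \big|\ \mathcal F_{t-}\big].$$ Moreover, existence, uniqueness and interior first-order-condition results hold under parameter restrictions, in the following precise form. Fix $t$, condition on $\mathcal F_{t-}$, write $J_t^\pm(\theta)=J_{\mathrm{ext}}^\pm(m_t,U_t^\pm(\theta);\gamma)$ and $\psi_t^N=\psi_t^N(\theta)$, and assume: (A1) $\Theta_{\mathrm{adm}}$ is nonempty and compact; (A2) $\psi_t^N(\theta)$, $J_t^\pm(\theta)$ and $\lambda_t^\pm(\theta,v_t)$ are twice continuously differentiable on $\Theta_{\mathrm{adm}}$, and differentiation may be passed under the expectation; (A3) $\Phi_t$ is strictly concave on $\Theta_{\mathrm{adm}}$. Then: (i) there exists a unique maximizer $\theta_t^*\in\arg\max_{\theta\in\Theta_{\mathrm{adm}}}\Phi_t(\theta)$; (ii) $\Phi_t$ is differentiable on $\mathrm{int}(\Theta_{\mathrm{adm}})$, and any interior maximizer satisfies $\Phi_t'(\theta_t^* )=0$, where (subscript $\theta$ denoting $\partial_\theta$) $$\Phi_t'(\theta)=-r^*+\psi_t^N(\theta)+\theta\psi^N_{\theta,t}(\theta)+\sum_\pm\Big[\lambda_t^\pm(\theta,v_t)H_t^\pm(\theta)+\frac{\lambda^\pm_{\theta,t}(\theta,v_t)}{1-\eta}G_t^\pm(\theta)\Big],$$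 $$G_t^\pm(\theta)=\mathbb E\big[(1+\theta J_t^\pm(\theta))^{1-\eta}-1\mid\mathcal F_{t-}\big],\qquad H_t^\pm(\theta)=\mathbb E\big[(J_t^\pm(\theta)+\theta J^\pm_{\theta,t}(\theta))(1+\theta J_t^\pm(\theta))^{-\eta}\mid\mathcal F_{t-}\big];$$ (iii) the maximizer is interior if and only if the one-sided derivatives satisfy $\Phi_t'(\theta_{\min})>0$ and $\Phi_t'(\theta_{\max})<0$. The interior optimal liquidity provision is denoted $\theta^*$.
   Context: Two assets $A$ (risky) and $B$ (numéraire). The external relative price satisfies $dP_t/P_t=\mu\,dt+\sqrt{v_t}\,dB_t$ with variance $dv_t=\kappa(\bar v-v_t)dt+\xi\sqrt{v_t}\,dW^v_t$, where $\kappa,\bar v,\xi>0$ and the Brownian motions $B,W^v$ satisfy $d\langle B,W^v\rangle_t=0$. The AMM is a constant-product pool with reserves $R_{A,t},R_{B,t}$, invariant $K_t=R_{A,t}R_{B,t}$, price $Q_t=R_{B,t}/R_{A,t}$, log-fee $\gamma$ (fees paid out, not added to reserves). $A^{out}_t$ is the LP's direct holding of $A$, $D_t$ its debt with borrowing rate $r^*$, and LP wealth is $W_t=A^{out}_tP_t+R_{A,t}P_t+R_{B,t}+F_t^N-D_t$, where $F^N$ is cumulative fee income from noise traders and $\dot F^N$ its rate, with $\mathbb E[\dot F_t^N\mid\mathcal F_{t-}]=Q_t(e^\gamma-e^{-\gamma})K_t^\beta\sigma_N\varphi\big(\frac1{\sigma_N}\sqrt{2g(v_t)/K_t^\beta}\big)$;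 here $\varphi$ is the standard normal density, $\sigma_N$ the standard deviation of noise traders' preference shocks, $\beta>0$, and $g$ the gas fee, an increasing, continuous, convex function of variance. $V^{\mathrm{AMM}}_{t-}(P_t)=P_tR_{A,t-}+R_{B,t-}$ is the value of the LP's pool position. $N^\pm$ count buy-side ($-$) and sell-side ($+$) arbitrage-correction blocks, with intensities $\lambda_t^\pm$ depending on $(\theta,v_t)$ (through the gas fee and pool depth). $M^\pm$ is the ratio of external price to pool price just before the correction ($M^->e^\gamma$, $M^+<e^{-\gamma}$ a.s.); its value at time $t$ is also written $m_t$. $U^-\in[0,1)$ and $U^+\ge0$ are the overrun ratios: the order flow in $A$ executed after the winning arbitrageur, divided by the pool's $A$-reserve after the winner's trade. The jump returns are $$J^-_{\mathrm{ext}}(m,u;\gamma)=\frac{e^{\gamma/2}\sqrt m\,\frac{u^2}{1-u}-(e^{\gamma/2}-\sqrt m)^2}{m+1},\qquad J^+_{\mathrm{ext}}(m,u;\gamma)=\frac{e^{-\gamma/2}\sqrt m\,\frac{u^2}{1+u}-(e^{-\gamma/2}-\sqrt m)^2}{m+1}.$$ The control $\theta_t$ scales the pool depth, $K_t=K(\theta_t)$. The proportional noise-fee yield is $\psi_t^N=\mathbb E[\dot F_t^N\mid\mathcal F_{t-}]/V^{\mathrm{AMM}}_{t-}(P_t)$, which depends on $\theta$ through $K$. *)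

theory Defs
  imports "HOL-Probability.Probability"
begin

section \<open>Stochastic-calculus vocabulary\<close>

text \<open>A process is a function of time and outcome; only times \<open>t \<ge> 0\<close> matter.\<close>

type_synonym 'a process = "real \<Rightarrow> 'a \<Rightarrow> real"

definition adapted :: "(real \<Rightarrow> 'a measure) \<Rightarrow> 'a process \<Rightarrow> bool" where
  "adapted F X \<longleftrightarrow> (\<forall>t\<ge>0. X t \<in> borel_measurable (F t))"

text \<open>\<open>F\<^sub>t\<^sub>-\<close>; only used for \<open>t > 0\<close>.\<close>

definition filt_before :: "'a measure \<Rightarrow> (real \<Rightarrow> 'a measure) \<Rightarrow> real \<Rightarrow> 'a measure" where
  "filt_before M F t = sigma (space M) (\<Union>s\<in>{0..<t}. sets (F s))"

definition predictable_algebra :: "'a measure \<Rightarrow> (real \<Rightarrow> 'a measure) \<Rightarrow> (real \<times> 'a) measure" where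
  "predictable_algebra M F = sigma ({0..} \<times> space M)
     ({{0} \<times> A |A. A \<in> sets (F 0)} \<union> {{s<..t} \<times> A |s t A. 0 \<le> s \<and> s \<le> t \<and> A \<in> sets (F s)})"

definition predictable :: "'a measure \<Rightarrow> (real \<Rightarrow> 'a measure) \<Rightarrow> 'a process \<Rightarrow> bool" where
  "predictable M F X \<longleftrightarrow> (\<lambda>(t, \<omega>). X t \<omega>) \<in> borel_measurable (predictable_algebra M F)"

definition left_limit :: "'a process \<Rightarrow> 'a process" where
  "left_limit X t \<omega> = (if t \<le> 0 then X 0 \<omega> else Lim (at_left t) (\<lambda>s. X s \<omega>))"

definition cadlag :: "'a measure \<Rightarrow> 'a process \<Rightarrow> bool" where
  "cadlag M X \<longleftrightarrow> (\<forall>\<omega>\<in>space M.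
     (\<forall>t\<ge>0. continuous (at_right t) (\<lambda>s. X s \<omega>)) \<and>
     (\<forall>t>0. \<exists>l. ((\<lambda>s. X s \<omega>) \<longlongrightarrow> l) (at_left t)))"

definition continuous_paths :: "'a measure \<Rightarrow> 'a process \<Rightarrow> bool" where
  "continuous_paths M X \<longleftrightarrow> (\<forall>\<omega>\<in>space M. continuous_on {0..} (\<lambda>t. X t \<omega>))"

definition conv_in_prob :: "'a measure \<Rightarrow> (nat \<Rightarrow> 'a \<Rightarrow> real) \<Rightarrow> ('a \<Rightarrow> real) \<Rightarrow> bool" where
  "conv_in_prob M X Y \<longleftrightarrow>
     (\<forall>\<epsilon>>0. (\<lambda>n. measure M {\<omega>\<in>space M. \<epsilon> < \<bar>X n \<omega> - Y \<omega>\<bar>}) \<longlonglongrightarrow> 0)"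

definition brownian_motion :: "'a measure \<Rightarrow> (real \<Rightarrow> 'a measure) \<Rightarrow> 'a process \<Rightarrow> bool" where
  "brownian_motion M F B \<longleftrightarrow> adapted F B \<and> continuous_paths M B \<and> (AE \<omega> in M. B 0 \<omega> = 0) \<and>
     (\<forall>s t. 0 \<le> s \<and> s < t \<longrightarrow>
        distributed M lborel (\<lambda>\<omega>. B t \<omega> - B s \<omega>) (normal_density 0 (sqrt (t - s))) \<and>
        prob_space.indep_set M (sets (F s))
          {(\<lambda>\<omega>. B t \<omega> - B s \<omega>) -` A \<inter> space M |A. A \<in> sets borel})"

definition zero_covariation :: "'a measure \<Rightarrow> 'a process \<Rightarrow> 'a process \<Rightarrow> bool" where
  "zero_covariation M X Y \<longleftrightarrow> (\<forall>t\<ge>0. \<forall>p :: nat \<Rightarrow> nat \<Rightarrow> real. \<forall>m :: nat \<Rightarrow> nat.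
     (\<forall>n. p n 0 = 0 \<and> p n (m n) = t \<and> (\<forall>i<m n. p n i \<le> p n (Suc i))) \<and>
     (\<forall>\<delta>>0. \<forall>\<^sub>F n in sequentially. \<forall>i<m n. p n (Suc i) - p n i < \<delta>) \<longrightarrow>
     conv_in_prob M
       (\<lambda>n \<omega>. \<Sum>i<m n. (X (p n (Suc i)) \<omega> - X (p n i) \<omega>) * (Y (p n (Suc i)) \<omega> - Y (p n i) \<omega>))
       (\<lambda>_. 0))"

text \<open>Simple predictable processes \<open>\<Sum>i<n. \<xi> i * indicator {\<tau> i<..\<tau> (i+1)}\<close> and their integrals.\<close>

definition simple_integrand ::
  "(real \<Rightarrow> 'a measure) \<Rightarrow> nat \<Rightarrow> (nat \<Rightarrow> real) \<Rightarrow> (nat \<Rightarrow> 'a \<Rightarrow> real) \<Rightarrow> bool" where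
  "simple_integrand F n \<tau> \<xi> \<longleftrightarrow> 0 \<le> \<tau> 0 \<and> (\<forall>i<n. \<tau> i \<le> \<tau> (Suc i) \<and>
     \<xi> i \<in> borel_measurable (F (\<tau> i)) \<and> (\<exists>C. \<forall>\<omega>\<in>space (F (\<tau> i)). \<bar>\<xi> i \<omega>\<bar> \<le> C))"

definition simple_process :: "nat \<Rightarrow> (nat \<Rightarrow> real) \<Rightarrow> (nat \<Rightarrow> 'a \<Rightarrow> real) \<Rightarrow> 'a process" where
  "simple_process n \<tau> \<xi> s \<omega> = (\<Sum>i<n. \<xi> i \<omega> * indicator {\<tau> i<..\<tau> (Suc i)} s)"

definition simple_integral ::
  "nat \<Rightarrow> (nat \<Rightarrow> real) \<Rightarrow> (nat \<Rightarrow> 'a \<Rightarrow> real) \<Rightarrow> 'a process \<Rightarrow> 'a process" where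
  "simple_integral n \<tau> \<xi> B t \<omega> =
     (\<Sum>i<n. \<xi> i \<omega> * (B (min t (\<tau> (Suc i))) \<omega> - B (min t (\<tau> i)) \<omega>))"

text \<open>\<open>I\<close> is the Ito integral of \<open>H\<close> against the Brownian motion \<open>B\<close>: the continuous process obtained
  as limit in probability of integrals of simple processes that approximate \<open>H\<close> in
  \<open>L\<^sup>2([0,T])\<close>, in probability.  The time integral is a Lebesgue integral of a nonnegative function,
  so that an infinite value is not mistaken for a small one.\<close>

definition ito_integral ::
  "'a measure \<Rightarrow> (real \<Rightarrow> 'a measure) \<Rightarrow> 'a process \<Rightarrow> 'a process \<Rightarrow> 'a process \<Rightarrow> bool" where
  "ito_integral M F B H I \<longleftrightarrow> adapted F I \<and> continuous_paths M I \<and>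
     (\<exists>n \<tau> \<xi>. (\<forall>k. simple_integrand F (n k) (\<tau> k) (\<xi> k)) \<and>
       (\<forall>T\<ge>0.
          (\<forall>\<epsilon>>0. (\<lambda>k. measure M {\<omega>\<in>space M. ennreal \<epsilon> <
              (\<integral>\<^sup>+ s\<in>{0..T}. ennreal ((simple_process (n k) (\<tau> k) (\<xi> k) s \<omega> - H s \<omega>)\<^sup>2) \<partial>lborel)}) \<longlonglongrightarrow> 0) \<and>
          conv_in_prob M (\<lambda>k. simple_integral (n k) (\<tau> k) (\<xi> k) B T) (I T)))"

definition jump_times :: "(real \<Rightarrow> 'a \<Rightarrow> nat) \<Rightarrow> 'a \<Rightarrow> real set" where
  "jump_times N \<omega> = {s. 0 < s \<and> \<not> (\<forall>\<^sub>F r in at_left s. N r \<omega> = N s \<omega>)}"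

text \<open>Adapted, started at 0, locally finitely many jumps, all of size 1.\<close>

definition counting_process :: "'a measure \<Rightarrow> (real \<Rightarrow> 'a measure) \<Rightarrow> (real \<Rightarrow> 'a \<Rightarrow> nat) \<Rightarrow> bool" where
  "counting_process M F N \<longleftrightarrow> adapted F (\<lambda>t \<omega>. real (N t \<omega>)) \<and>
     (\<forall>\<omega>\<in>space M. \<forall>t\<ge>0. finite (jump_times N \<omega> \<inter> {..t}) \<and> N t \<omega> = card (jump_times N \<omega> \<inter> {..t}))"

text \<open>\<open>k\<close> is a regular conditional probability given the sub-sigma-algebra \<open>G\<close>; the integral of \<open>X\<close>
  with respect to \<open>k \<omega>\<close> is then a version of \<open>E[X | G](\<omega>)\<close>, simultaneously for all \<open>X\<close>.\<close>

definition regular_cond_prob :: "'a measure \<Rightarrow> 'a measure \<Rightarrow> ('a \<Rightarrow> 'a measure) \<Rightarrow> bool" where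
  "regular_cond_prob M G k \<longleftrightarrow> subalgebra M G \<and> k \<in> measurable G (prob_algebra M) \<and>
     (\<forall>A\<in>sets M. AE \<omega> in M. real_cond_exp M G (indicator A) \<omega> = measure (k \<omega>) A)"


section \<open>Calculus on a subset of the line\<close>

text \<open>Derivative relative to \<open>S\<close>: the one-sided derivative at an end point of an interval \<open>S\<close>.\<close>

abbreviation deriv_within :: "real set \<Rightarrow> (real \<Rightarrow> real) \<Rightarrow> real \<Rightarrow> real" where
  "deriv_within S f x \<equiv> vector_derivative f (at x within S)"

definition C2_on :: "real set \<Rightarrow> (real \<Rightarrow> real) \<Rightarrow> bool" where
  "C2_on S f \<longleftrightarrow> (\<exists>f' f''.
     (\<forall>x\<in>S. (f has_real_derivative f' x) (at x within S)) \<and>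
     (\<forall>x\<in>S. (f' has_real_derivative f'' x) (at x within S)) \<and> continuous_on S f'')"

text \<open>Strict concavity on \<open>S\<close> includes convexity of \<open>S\<close>, as in \<open>convex_on\<close>/\<open>concave_on\<close>.\<close>

definition strictly_concave_on :: "real set \<Rightarrow> (real \<Rightarrow> real) \<Rightarrow> bool" where
  "strictly_concave_on S f \<longleftrightarrow> convex S \<and>
     (\<forall>x\<in>S. \<forall>y\<in>S. \<forall>u. x \<noteq> y \<and> 0 < u \<and> u < 1 \<longrightarrow>
        (1 - u) * f x + u * f y < f ((1 - u) * x + u * y))"


section \<open>The liquidity-provision model\<close>

text \<open>\<open>Buy\<close> is the side written with superscript \<open>-\<close>, \<open>Sell\<close> the side written with \<open>+\<close>.\<close>

datatype side = Buy | Sell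

text \<open>\<open>J_ext \<gamma> side m u\<close>: jump return at mispricing ratio \<open>m\<close> and overrun ratio \<open>u\<close>.\<close>

fun J_ext :: "real \<Rightarrow> side \<Rightarrow> real \<Rightarrow> real \<Rightarrow> real" where
  "J_ext \<gamma> Buy m u =
     (exp (\<gamma> / 2) * sqrt m * (u\<^sup>2 / (1 - u)) - (exp (\<gamma> / 2) - sqrt m)\<^sup>2) / (m + 1)"
| "J_ext \<gamma> Sell m u =
     (exp (- \<gamma> / 2) * sqrt m * (u\<^sup>2 / (1 + u)) - (exp (- \<gamma> / 2) - sqrt m)\<^sup>2) / (m + 1)"

text \<open>Primitives.  \<open>pool_price t\<close> is the pool price \<open>Q\<close> prevailing just before time \<open>t\<close>.
  \<open>ratio sd t\<close> is \<open>M\<close>; \<open>overrun sd t \<theta> v\<close> is \<open>U(\<theta>,v)\<close> (a random variable); they are the marks of a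
  correction block executed at time \<open>t\<close>.  \<open>depth \<theta>\<close> is the pool invariant \<open>K(\<theta>)\<close>.
  \<open>cond_law t\<close> is the regular conditional probability given \<open>F\<^sub>t\<^sub>-\<close>.\<close>

record 'a lp_model =
  pspace :: "'a measure"
  filt :: "real \<Rightarrow> 'a measure"
  cond_law :: "real \<Rightarrow> 'a \<Rightarrow> 'a measure"
  BM :: "'a process"
  BMv :: "'a process"
  ext_price :: "'a process"
  variance :: "'a process"
  pool_price :: "'a process"
  borrow_rate :: "'a process"
  ratio :: "side \<Rightarrow> 'a process"
  overrun :: "side \<Rightarrow> real \<Rightarrow> real \<Rightarrow> real \<Rightarrow> 'a \<Rightarrow> real"
  intensity :: "side \<Rightarrow> real \<Rightarrow> real \<Rightarrow> real"
  depth :: "real \<Rightarrow> real"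
  gas_fee :: "real \<Rightarrow> real"
  mu :: real
  kappa :: real
  vbar :: real
  xi :: real
  gam :: real
  sigmaN :: real
  beta :: real
  rho :: real
  eta :: real
  theta_min :: real
  theta_max :: real

text \<open>The reserves are the positive solution of \<open>R\<^sub>A * R\<^sub>B = K\<close>, \<open>R\<^sub>B / R\<^sub>A = q\<close>.\<close>

definition reserve_A :: "real \<Rightarrow> real \<Rightarrow> real" where "reserve_A K q = sqrt (K / q)"
definition reserve_B :: "real \<Rightarrow> real \<Rightarrow> real" where "reserve_B K q = sqrt (K * q)"

definition pool_value :: "'a lp_model \<Rightarrow> real \<Rightarrow> 'a \<Rightarrow> real \<Rightarrow> real" where
  "pool_value L t \<omega> \<theta> =
     ext_price L t \<omega> * reserve_A (depth L \<theta>) (pool_price L t \<omega>) + reserve_B (depth L \<theta>) (pool_price L t \<omega>)"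

text \<open>Conditional expectation, given \<open>F\<^sub>t\<^sub>-\<close>, of the noise-trader fee rate of a pool with invariant \<open>K(\<theta>)\<close>.\<close>

definition noise_fee_rate :: "'a lp_model \<Rightarrow> real \<Rightarrow> 'a \<Rightarrow> real \<Rightarrow> real" where
  "noise_fee_rate L t \<omega> \<theta> =
     pool_price L t \<omega> * (exp (gam L) - exp (- gam L)) * depth L \<theta> powr beta L * sigmaN L *
     std_normal_density
       (1 / sigmaN L * sqrt (2 * gas_fee L (variance L t \<omega>) / depth L \<theta> powr beta L))"

definition noise_yield :: "'a lp_model \<Rightarrow> real \<Rightarrow> 'a \<Rightarrow> real \<Rightarrow> real" where
  "noise_yield L t \<omega> \<theta> = noise_fee_rate L t \<omega> \<theta> / pool_value L t \<omega> \<theta>"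

text \<open>\<open>J(M, U(\<theta>, v\<^sub>t))\<close> in outcome \<open>\<omega>'\<close>, the \<open>F\<^sub>t\<^sub>-\<close>-measurable variance \<open>v\<^sub>t\<close> being frozen at
  its value in the outcome \<open>\<omega>\<close> on which one conditions.\<close>

definition jump_ret :: "'a lp_model \<Rightarrow> side \<Rightarrow> real \<Rightarrow> 'a \<Rightarrow> real \<Rightarrow> 'a \<Rightarrow> real" where
  "jump_ret L sd t \<omega> \<theta> \<omega>' =
     J_ext (gam L) sd (ratio L sd t \<omega>') (overrun L sd t \<theta> (variance L t \<omega>) \<omega>')"

definition wealth_drift :: "'a lp_model \<Rightarrow> real \<Rightarrow> 'a \<Rightarrow> real \<Rightarrow> real" where
  "wealth_drift L t \<omega> \<theta> = mu L - borrow_rate L t \<omega> * \<theta> + \<theta> * noise_yield L t \<omega> \<theta>"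

definition price_dynamics :: "'a lp_model \<Rightarrow> bool" where
  "price_dynamics L \<longleftrightarrow>
     (let M = pspace L; P = ext_price L; v = variance L in
      adapted (filt L) P \<and> continuous_paths M P \<and> (\<forall>\<omega>\<in>space M. \<forall>t\<ge>0. 0 < P t \<omega>) \<and>
      (\<exists>I. ito_integral M (filt L) (BM L) (\<lambda>s \<omega>. sqrt (v s \<omega>) * P s \<omega>) I \<and>
        (AE \<omega> in M. \<forall>t\<ge>0. P t \<omega> = P 0 \<omega> + (LBINT s:{0..t}. mu L * P s \<omega>) + I t \<omega>)))"

definition variance_dynamics :: "'a lp_model \<Rightarrow> bool" where
  "variance_dynamics L \<longleftrightarrow>
     (let M = pspace L; v = variance L in
      adapted (filt L) v \<and> continuous_paths M v \<and> (\<forall>\<omega>\<in>space M. \<forall>t\<ge>0. 0 \<le> v t \<omega>) \<and>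
      (\<exists>I. ito_integral M (filt L) (BMv L) (\<lambda>s \<omega>. xi L * sqrt (v s \<omega>)) I \<and>
        (AE \<omega> in M. \<forall>t\<ge>0.
           v t \<omega> = v 0 \<omega> + (LBINT s:{0..t}. kappa L * (vbar L - v s \<omega>)) + I t \<omega>)))"

definition lp_model_axioms :: "'a lp_model \<Rightarrow> bool" where
  "lp_model_axioms L \<longleftrightarrow>
     (let M = pspace L; F = filt L; \<Theta> = {theta_min L..theta_max L} in
      prob_space M \<and> filtration (space M) F \<and> (\<forall>t. sets (F t) \<subseteq> sets M) \<and>
      (\<forall>t>0. regular_cond_prob M (filt_before M F t) (cond_law L t)) \<and>
      brownian_motion M F (BM L) \<and> brownian_motion M F (BMv L) \<and> zero_covariation M (BM L) (BMv L) \<and>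
      0 < kappa L \<and> 0 < vbar L \<and> 0 < xi L \<and> 0 < sigmaN L \<and> 0 < beta L \<and>
      0 < rho L \<and> 0 < eta L \<and> eta L \<noteq> 1 \<and>
      mono_on {0..} (gas_fee L) \<and> continuous_on {0..} (gas_fee L) \<and> convex_on {0..} (gas_fee L) \<and>
      (\<forall>v\<ge>0. 0 \<le> gas_fee L v) \<and> (\<forall>\<theta>\<in>\<Theta>. 0 \<le> depth L \<theta>) \<and>
      price_dynamics L \<and> variance_dynamics L \<and>
      predictable M F (pool_price L) \<and> (\<forall>\<omega>\<in>space M. \<forall>t\<ge>0. 0 < pool_price L t \<omega>) \<and>
      predictable M F (borrow_rate L) \<and>
      (\<forall>sd. \<forall>\<theta>\<in>\<Theta>. \<forall>v\<ge>0. 0 \<le> intensity L sd \<theta> v) \<and>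
      (\<forall>sd. \<forall>t>0. ratio L sd t \<in> borel_measurable M) \<and>
      (\<forall>sd. \<forall>t>0. \<forall>\<theta> v. overrun L sd t \<theta> v \<in> borel_measurable M) \<and>
      (\<forall>t>0. AE \<omega> in M. exp (gam L) < ratio L Buy t \<omega>) \<and>
      (\<forall>t>0. AE \<omega> in M. 0 < ratio L Sell t \<omega> \<and> ratio L Sell t \<omega> < exp (- gam L)) \<and>
      (\<forall>t>0. \<forall>\<theta>\<in>\<Theta>. \<forall>v\<ge>0. AE \<omega> in M. 0 \<le> overrun L Buy t \<theta> v \<omega> \<and> overrun L Buy t \<theta> v \<omega> < 1) \<and>
      (\<forall>t>0. \<forall>\<theta>\<in>\<Theta>. \<forall>v\<ge>0. AE \<omega> in M. 0 \<le> overrun L Sell t \<theta> v \<omega>))"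


section \<open>The control problem\<close>

definition control :: "'a lp_model \<Rightarrow> 'a process \<Rightarrow> bool" where
  "control L \<theta> \<longleftrightarrow> predictable (pspace L) (filt L) \<theta> \<and>
     (\<forall>\<omega>\<in>space (pspace L). \<forall>t\<ge>0. \<theta> t \<omega> \<in> {theta_min L..theta_max L})"

text \<open>\<open>N\<close> counts the correction blocks of side \<open>sd\<close>: under the control \<open>\<theta>\<close> it has intensity
  \<open>\<lambda>(\<theta>\<^sub>t, v\<^sub>t)\<close> and its marks \<open>(M, U(\<theta>\<^sub>t, v\<^sub>t))\<close> follow their conditional law given \<open>F\<^sub>t\<^sub>-\<close>
  (local characteristics of a marked point process; \<open>h = 1\<close> is the intensity property).\<close>

definition correction_process ::
  "'a lp_model \<Rightarrow> 'a process \<Rightarrow> side \<Rightarrow> (real \<Rightarrow> 'a \<Rightarrow> nat) \<Rightarrow> bool" where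
  "correction_process L \<theta> sd N \<longleftrightarrow> counting_process (pspace L) (filt L) N \<and>
     (\<forall>C :: real \<times> 'a \<Rightarrow> ennreal. \<forall>h :: real \<times> real \<Rightarrow> ennreal.
        C \<in> borel_measurable (predictable_algebra (pspace L) (filt L)) \<and> h \<in> borel_measurable borel \<longrightarrow>
        (\<integral>\<^sup>+ \<omega>. (\<integral>\<^sup>+ s. C (s, \<omega>) *
              h (ratio L sd s \<omega>, overrun L sd s (\<theta> s \<omega>) (variance L s \<omega>) \<omega>)
            \<partial>count_space (jump_times N \<omega>)) \<partial>pspace L) =
        (\<integral>\<^sup>+ \<omega>. (\<integral>\<^sup>+ s\<in>{0<..}. C (s, \<omega>) * ennreal (intensity L sd (\<theta> s \<omega>) (variance L s \<omega>)) *
              (\<integral>\<^sup>+ \<omega>'. h (ratio L sd s \<omega>', overrun L sd s (\<theta> s \<omega>) (variance L s \<omega>) \<omega>')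
                 \<partial>cond_law L s \<omega>)
            \<partial>lborel) \<partial>pspace L))"

text \<open>\<open>jump_sum L \<theta> N X t\<close> is \<open>\<Sum>\<^sub>\<plusminus> \<integral>\<^sub>0\<^sup>t X\<^sub>s J\<^sub>s dN\<^sub>s\<close>.\<close>

definition jump_sum :: "'a lp_model \<Rightarrow> 'a process \<Rightarrow> (side \<Rightarrow> real \<Rightarrow> 'a \<Rightarrow> nat) \<Rightarrow> 'a process \<Rightarrow> 'a process" where
  "jump_sum L \<theta> N X t \<omega> =
     (\<Sum>sd\<in>{Buy, Sell}. \<Sum>s\<in>jump_times (N sd) \<omega> \<inter> {..t}. X s \<omega> * jump_ret L sd s \<omega> (\<theta> s \<omega>) \<omega>)"

text \<open>\<open>dW = (A\<^sup>o\<^sup>u\<^sup>t + R\<^sub>A) dP - r D dt + F' dt + \<Sum>\<^sub>\<plusminus> V\<^sup>A\<^sup>M\<^sup>M J dN\<close>, with \<open>dP = \<mu> P dt + \<surd>v P dB\<close>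
  substituted in the first integral.  The pool position is \<open>n\<^sub>t\<close> times a constant-product pool with
  invariant \<open>K(\<theta>\<^sub>t)\<close> at price \<open>Q\<^sub>t\<close> (\<open>n\<close> is the unit in which the position is measured: the coefficients
  of the proportional form depend on \<open>\<theta>\<close> but not on wealth, so the unit has to be free).\<close>

definition lp_wealth_dynamics ::
  "'a lp_model \<Rightarrow> real \<Rightarrow> 'a process \<Rightarrow> (side \<Rightarrow> real \<Rightarrow> 'a \<Rightarrow> nat) \<Rightarrow> 'a process \<Rightarrow> bool" where
  "lp_wealth_dynamics L w \<theta> N W \<longleftrightarrow>
     (let M = pspace L; F = filt L; P = ext_price L; v = variance L in
      \<exists>Aout n D Fdot I.
        predictable M F Aout \<and> predictable M F n \<and> predictable M F D \<and>
        (\<forall>t\<ge>0. Fdot t \<in> borel_measurable M) \<and>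
        (\<forall>t>0. AE \<omega> in M.
           real_cond_exp M (filt_before M F t) (Fdot t) \<omega> = n t \<omega> * noise_fee_rate L t \<omega> (\<theta> t \<omega>)) \<and>
        (let RA = (\<lambda>t \<omega>. n t \<omega> * reserve_A (depth L (\<theta> t \<omega>)) (pool_price L t \<omega>));
             VAMM = (\<lambda>t \<omega>. n t \<omega> * pool_value L t \<omega> (\<theta> t \<omega>));
             drift = (\<lambda>t \<omega>. (Aout t \<omega> + RA t \<omega>) * (mu L * P t \<omega>)
                            - borrow_rate L t \<omega> * D t \<omega> + Fdot t \<omega>)
         in ito_integral M F (BM L) (\<lambda>s \<omega>. (Aout s \<omega> + RA s \<omega>) * (sqrt (v s \<omega>) * P s \<omega>)) I \<and>
            (AE \<omega> in M. \<forall>t\<ge>0. set_integrable lborel {0..t} (\<lambda>s. drift s \<omega>) \<and>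
               W t \<omega> = w + (LBINT s:{0..t}. drift s \<omega>) + I t \<omega> + jump_sum L \<theta> N VAMM t \<omega>)))"

text \<open>\<open>dW / W\<^sub>- = (\<mu> - r \<theta> + \<theta> \<psi>) dt + \<surd>v dB + \<Sum>\<^sub>\<plusminus> \<theta> J dN\<close>.\<close>

definition proportional_dynamics ::
  "'a lp_model \<Rightarrow> real \<Rightarrow> 'a process \<Rightarrow> (side \<Rightarrow> real \<Rightarrow> 'a \<Rightarrow> nat) \<Rightarrow> 'a process \<Rightarrow> bool" where
  "proportional_dynamics L w \<theta> N W \<longleftrightarrow>
     (let M = pspace L; v = variance L; drift = (\<lambda>t \<omega>. left_limit W t \<omega> * wealth_drift L t \<omega> (\<theta> t \<omega>)) in
      \<exists>I. ito_integral M (filt L) (BM L) (\<lambda>s \<omega>. left_limit W s \<omega> * sqrt (v s \<omega>)) I \<and>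
          (AE \<omega> in M. \<forall>t\<ge>0. set_integrable lborel {0..t} (\<lambda>s. drift s \<omega>) \<and>
             W t \<omega> = w + (LBINT s:{0..t}. drift s \<omega>) + I t \<omega> +
                     jump_sum L \<theta> N (\<lambda>s \<omega>. left_limit W s \<omega> * \<theta> s \<omega>) t \<omega>))"

definition controlled_wealth :: "'a lp_model \<Rightarrow> real \<Rightarrow> 'a process \<Rightarrow> 'a process \<Rightarrow> bool" where
  "controlled_wealth L w \<theta> W \<longleftrightarrow> control L \<theta> \<and>
     adapted (filt L) W \<and> cadlag (pspace L) W \<and> (\<forall>\<omega>\<in>space (pspace L). \<forall>t\<ge>0. 0 < W t \<omega>) \<and>
     (\<exists>N. (\<forall>sd. correction_process L \<theta> sd (N sd)) \<and>
          lp_wealth_dynamics L w \<theta> N W \<and> proportional_dynamics L w \<theta> N W)"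

text \<open>\<open>E \<integral>\<^sub>0\<^sup>\<infinity> e\<^sup>-\<^sup>\<rho>\<^sup>t W\<^sub>t\<^sup>1\<^sup>-\<^sup>\<eta> / (1-\<eta>) dt\<close> as an extended real; the integrand has the constant sign of
  \<open>1 - \<eta>\<close>, so the factor \<open>1 / (1 - \<eta>)\<close> is taken out and the rest is a nonnegative integral.\<close>

definition expected_utility :: "'a lp_model \<Rightarrow> 'a process \<Rightarrow> ereal" where
  "expected_utility L W = ereal (1 / (1 - eta L)) *
     enn2ereal (\<integral>\<^sup>+ \<omega>. (\<integral>\<^sup>+ t\<in>{0..}. ennreal (exp (- rho L * t) * W t \<omega> powr (1 - eta L)) \<partial>lborel) \<partial>pspace L)"

definition value_function :: "'a lp_model \<Rightarrow> real \<Rightarrow> ereal" where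
  "value_function L w = (SUP (\<theta>, W) \<in> {(\<theta>, W). controlled_wealth L w \<theta> W}. expected_utility L W)"


section \<open>Hamilton-Jacobi-Bellman equation and the pointwise objective\<close>

text \<open>From here on everything is conditional on \<open>F\<^sub>t\<^sub>-\<close>, at the outcome \<open>\<omega>\<close>: probabilities and
  expectations are those of \<open>cond_law L t \<omega>\<close>.\<close>

definition Theta_adm :: "'a lp_model \<Rightarrow> real \<Rightarrow> 'a \<Rightarrow> real set" where
  "Theta_adm L t \<omega> = {\<theta>\<in>{theta_min L..theta_max L}.
     \<forall>sd. AE \<omega>' in cond_law L t \<omega>. 0 < 1 + \<theta> * jump_ret L sd t \<omega> \<theta> \<omega>'}"

text \<open>Flow utility plus the generator of \<open>(W, v)\<close> under the constant control \<open>\<theta>\<close>, applied to \<open>V\<close> at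
  wealth \<open>w\<close> and variance \<open>v\<^sub>t(\<omega>)\<close>.  There is no mixed second derivative because the two
  Brownian motions have zero covariation.\<close>

definition hjb_objective :: "'a lp_model \<Rightarrow> (real \<Rightarrow> real \<Rightarrow> real) \<Rightarrow> real \<Rightarrow> 'a \<Rightarrow> real \<Rightarrow> real \<Rightarrow> real" where
  "hjb_objective L V t \<omega> w \<theta> =
     (let y = variance L t \<omega> in
      w powr (1 - eta L) / (1 - eta L)
      + w * wealth_drift L t \<omega> \<theta> * deriv (\<lambda>x. V x y) w
      + 1 / 2 * (w * sqrt y)\<^sup>2 * (deriv ^^ 2) (\<lambda>x. V x y) w
      + kappa L * (vbar L - y) * deriv (V w) y
      + 1 / 2 * (xi L * sqrt y)\<^sup>2 * (deriv ^^ 2) (V w) y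
      + (\<Sum>sd\<in>{Buy, Sell}. intensity L sd \<theta> y *
           (\<integral>\<omega>'. V (w + w * (\<theta> * jump_ret L sd t \<omega> \<theta> \<omega>')) y - V w y \<partial>cond_law L t \<omega>)))"

definition hjb_equation :: "'a lp_model \<Rightarrow> (real \<Rightarrow> real \<Rightarrow> real) \<Rightarrow> real \<Rightarrow> 'a \<Rightarrow> real \<Rightarrow> bool" where
  "hjb_equation L V t \<omega> w \<longleftrightarrow>
     ereal (rho L * V w (variance L t \<omega>)) = (SUP \<theta>\<in>Theta_adm L t \<omega>. ereal (hjb_objective L V t \<omega> w \<theta>))"

definition crra_value :: "real \<Rightarrow> (real \<Rightarrow> real) \<Rightarrow> real \<Rightarrow> real \<Rightarrow> real" where
  "crra_value \<eta> f w y = f y * (w powr (1 - \<eta>) / (1 - \<eta>))"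

definition utility_gain :: "'a lp_model \<Rightarrow> side \<Rightarrow> real \<Rightarrow> 'a \<Rightarrow> real \<Rightarrow> 'a \<Rightarrow> real" where
  "utility_gain L sd t \<omega> \<theta> \<omega>' = (1 + \<theta> * jump_ret L sd t \<omega> \<theta> \<omega>') powr (1 - eta L) - 1"

definition G_fun :: "'a lp_model \<Rightarrow> side \<Rightarrow> real \<Rightarrow> 'a \<Rightarrow> real \<Rightarrow> real" where
  "G_fun L sd t \<omega> \<theta> = (\<integral>\<omega>'. utility_gain L sd t \<omega> \<theta> \<omega>' \<partial>cond_law L t \<omega>)"

definition Phi :: "'a lp_model \<Rightarrow> real \<Rightarrow> 'a \<Rightarrow> real \<Rightarrow> real" where
  "Phi L t \<omega> \<theta> =
     mu L - borrow_rate L t \<omega> * \<theta> - eta L / 2 * variance L t \<omega> + \<theta> * noise_yield L t \<omega> \<theta>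
     + (\<Sum>sd\<in>{Buy, Sell}. intensity L sd \<theta> (variance L t \<omega>) / (1 - eta L) * G_fun L sd t \<omega> \<theta>)"

definition H_integrand :: "'a lp_model \<Rightarrow> side \<Rightarrow> real \<Rightarrow> 'a \<Rightarrow> real \<Rightarrow> 'a \<Rightarrow> real" where
  "H_integrand L sd t \<omega> \<theta> \<omega>' =
     (jump_ret L sd t \<omega> \<theta> \<omega>'
      + \<theta> * deriv_within (Theta_adm L t \<omega>) (\<lambda>\<theta>. jump_ret L sd t \<omega> \<theta> \<omega>') \<theta>)
     * (1 + \<theta> * jump_ret L sd t \<omega> \<theta> \<omega>') powr (- eta L)"

definition H_fun :: "'a lp_model \<Rightarrow> side \<Rightarrow> real \<Rightarrow> 'a \<Rightarrow> real \<Rightarrow> real" where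
  "H_fun L sd t \<omega> \<theta> = (\<integral>\<omega>'. H_integrand L sd t \<omega> \<theta> \<omega>' \<partial>cond_law L t \<omega>)"

definition Phi_prime :: "'a lp_model \<Rightarrow> real \<Rightarrow> 'a \<Rightarrow> real \<Rightarrow> real" where
  "Phi_prime L t \<omega> \<theta> =
     (let S = Theta_adm L t \<omega>; y = variance L t \<omega> in
      - borrow_rate L t \<omega> + noise_yield L t \<omega> \<theta> + \<theta> * deriv_within S (noise_yield L t \<omega>) \<theta>
      + (\<Sum>sd\<in>{Buy, Sell}. intensity L sd \<theta> y * H_fun L sd t \<omega> \<theta>
           + deriv_within S (\<lambda>\<theta>. intensity L sd \<theta> y) \<theta> / (1 - eta L) * G_fun L sd t \<omega> \<theta>))"

definition assumption_A1 :: "'a lp_model \<Rightarrow> real \<Rightarrow> 'a \<Rightarrow> bool" where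
  "assumption_A1 L t \<omega> \<longleftrightarrow> Theta_adm L t \<omega> \<noteq> {} \<and> compact (Theta_adm L t \<omega>)"

text \<open>\<open>diff_under_expectation\<close>: the expectations \<open>G\<close>, \<open>H\<close> exist, and the derivative of the
  expectation of the utility gain is the expectation of its derivative.\<close>

definition diff_under_expectation :: "'a lp_model \<Rightarrow> real \<Rightarrow> 'a \<Rightarrow> bool" where
  "diff_under_expectation L t \<omega> \<longleftrightarrow>
     (let S = Theta_adm L t \<omega>; k = cond_law L t \<omega> in
      \<forall>sd. \<forall>\<theta>\<in>S.
        integrable k (utility_gain L sd t \<omega> \<theta>) \<and> integrable k (H_integrand L sd t \<omega> \<theta>) \<and>
        integrable k (\<lambda>\<omega>'. deriv_within S (\<lambda>\<theta>. utility_gain L sd t \<omega> \<theta> \<omega>') \<theta>) \<and>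
        (G_fun L sd t \<omega> has_real_derivative
           (\<integral>\<omega>'. deriv_within S (\<lambda>\<theta>. utility_gain L sd t \<omega> \<theta> \<omega>') \<theta> \<partial>k)) (at \<theta> within S))"

definition assumption_A2 :: "'a lp_model \<Rightarrow> real \<Rightarrow> 'a \<Rightarrow> bool" where
  "assumption_A2 L t \<omega> \<longleftrightarrow>
     (let S = Theta_adm L t \<omega> in
      C2_on S (noise_yield L t \<omega>) \<and>
      (\<forall>sd. C2_on S (\<lambda>\<theta>. intensity L sd \<theta> (variance L t \<omega>))) \<and>
      (\<forall>sd. AE \<omega>' in cond_law L t \<omega>. C2_on S (\<lambda>\<theta>. jump_ret L sd t \<omega> \<theta> \<omega>')) \<and>
      diff_under_expectation L t \<omega>)"

definition assumption_A3 :: "'a lp_model \<Rightarrow> real \<Rightarrow> 'a \<Rightarrow> bool" where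
  "assumption_A3 L t \<omega> \<longleftrightarrow> strictly_concave_on (Theta_adm L t \<omega>) (Phi L t \<omega>)"

end

theory Submission
  imports Defs
begin

text \<open>
  All dynamics are linear in wealth, so multiplying an admissible wealth process by \<open>c > 0\<close>
  gives an admissible wealth process for the same control from \<open>c\<close> times the initial wealth, while the expected utility
  is multiplied by \<open>c powr (1 - \<eta>)\<close>.  Hence the value function is homogeneous of degree \<open>1 - \<eta>\<close>.
  Inserting \<open>f y * w powr (1 - \<eta>) / (1 - \<eta>)\<close> into the HJB objective, every term containing the
  control acquires the common factor \<open>f y * w powr (1 - \<eta>) > 0\<close>, and what remains of these terms is \<open>\<Phi>\<close>.
  For the last part, the derivative of the utility gain is \<open>1 - \<eta>\<close> times the integrand of \<open>H\<close>
  almost surely; a strictly concave function lies strictly below its tangents, and applying this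
  to the tangents at the end points of the interval gives the signs in (iii).
\<close>

section \<open>Homogeneity of the value function\<close>

text \<open>The integrands met below come without measurability hypotheses, so the factor is moved
  through the supremum over simple minorants. This yields one inequality for any factor; the reverse
  one is the same inequality for \<open>1 / c\<close>.\<close>

lemma nn_integral_cmult_pos:
  fixes f :: "'b \<Rightarrow> ennreal"
  assumes "0 < c"
  shows "(\<integral>\<^sup>+ x. ennreal c * f x \<partial>M) = ennreal c * (\<integral>\<^sup>+ x. f x \<partial>M)"
proof (rule antisym)
  have ge: "ennreal d * (\<integral>\<^sup>+ x. g x \<partial>M) \<le> (\<integral>\<^sup>+ x. ennreal d * g x \<partial>M)"
    for d and g :: "'b \<Rightarrow> ennreal"
    unfolding nn_integral_def SUP_mult_left_ennreal
  proof (rule SUP_least, safe)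
    fix s :: "'b \<Rightarrow> ennreal"
    assume s: "simple_function M s" "s \<le> g"
    then show "ennreal d * integral\<^sup>S M s
        \<le> (SUP h\<in>{h. simple_function M h \<and> h \<le> (\<lambda>x. ennreal d * g x)}. integral\<^sup>S M h)"
      by (intro SUP_upper2[of "\<lambda>x. ennreal d * s x"])
        (auto simp: le_fun_def intro!: mult_left_mono)
  qed
  show "ennreal c * (\<integral>\<^sup>+ x. f x \<partial>M) \<le> (\<integral>\<^sup>+ x. ennreal c * f x \<partial>M)"
    by (rule ge)
  have cancel: "ennreal (1 / c) * (ennreal c * z) = z" "ennreal c * (ennreal (1 / c) * z) = z" for z
    using assms by (simp_all add: mult.assoc[symmetric] ennreal_mult[symmetric])
  have "ennreal (1 / c) * (\<integral>\<^sup>+ x. ennreal c * f x \<partial>M) \<le> (\<integral>\<^sup>+ x. f x \<partial>M)"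
    using ge[of "1 / c" "\<lambda>x. ennreal c * f x"] by (simp add: cancel)
  then have "ennreal c * (ennreal (1 / c) * (\<integral>\<^sup>+ x. ennreal c * f x \<partial>M))
      \<le> ennreal c * (\<integral>\<^sup>+ x. f x \<partial>M)"
    by (intro mult_left_mono) auto
  then show "(\<integral>\<^sup>+ x. ennreal c * f x \<partial>M) \<le> ennreal c * (\<integral>\<^sup>+ x. f x \<partial>M)"
    by (simp only: cancel)
qed

text \<open>The noise fee rate is measurable but may fail to be integrable. The factor is therefore
  pulled out of the two nonnegative conditional expectations whose difference defines
  \<open>real_cond_exp\<close>; positivity of \<open>c\<close> keeps positive and negative part
  apart.\<close>

lemma (in sigma_finite_subalgebra) real_cond_exp_cmult_pos:
  assumes c: "0 < c" and [measurable]: "f \<in> borel_measurable M"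
  shows "AE x in M. real_cond_exp M F (\<lambda>x. c * f x) x = c * real_cond_exp M F f x"
proof -
  have *: "AE x in M. ennreal c * nn_cond_exp M F (\<lambda>x. ennreal (g x)) x =
      nn_cond_exp M F (\<lambda>x. ennreal (c * g x)) x" if [measurable]: "g \<in> borel_measurable M" for g
    using nn_cond_exp_prod[of "\<lambda>_. ennreal c" "\<lambda>x. ennreal (g x)"] c
    by (simp add: ennreal_mult')
  have "AE x in M. ennreal c * nn_cond_exp M F (\<lambda>x. ennreal (f x)) x =
      nn_cond_exp M F (\<lambda>x. ennreal (c * f x)) x" by (rule *) simp
  moreover have "AE x in M. ennreal c * nn_cond_exp M F (\<lambda>x. ennreal (- f x)) x =
      nn_cond_exp M F (\<lambda>x. ennreal (- (c * f x))) x" using *[of "\<lambda>x. - f x"] by simp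
  ultimately show ?thesis
    unfolding real_cond_exp_def
  proof eventually_elim
    case (elim x)
    show ?case
      using c by (simp add: elim[symmetric] enn2real_mult right_diff_distrib)
  qed
qed

lemma conv_in_prob_cmult:
  assumes "0 < c" "conv_in_prob M X Y"
  shows "conv_in_prob M (\<lambda>n \<omega>. c * X n \<omega>) (\<lambda>\<omega>. c * Y \<omega>)"
  unfolding conv_in_prob_def
proof (intro allI impI)
  fix \<epsilon> :: real assume "0 < \<epsilon>"
  then have "(\<lambda>n. measure M {\<omega>\<in>space M. \<epsilon> / c < \<bar>X n \<omega> - Y \<omega>\<bar>}) \<longlonglongrightarrow> 0"
    using assms by (simp add: conv_in_prob_def)
  moreover have "\<epsilon> / c < \<bar>X n \<omega> - Y \<omega>\<bar> \<longleftrightarrow> \<epsilon> < \<bar>c * X n \<omega> - c * Y \<omega>\<bar>" for n \<omega>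
    using assms(1) by (simp only: right_diff_distrib[symmetric] abs_mult abs_of_pos pos_divide_less_eq mult.commute)
  ultimately show "(\<lambda>n. measure M {\<omega>\<in>space M. \<epsilon> < \<bar>c * X n \<omega> - c * Y \<omega>\<bar>}) \<longlonglongrightarrow> 0"
    by simp
qed

lemma adapted_cmult: "adapted F X \<Longrightarrow> adapted F (\<lambda>t \<omega>. c * X t \<omega>)"
  by (auto simp: adapted_def)

lemma predictable_cmult: "predictable M F X \<Longrightarrow> predictable M F (\<lambda>t \<omega>. c * X t \<omega>)"
  unfolding predictable_def using borel_measurable_times[OF borel_measurable_const[of c]]
  by (fastforce simp: case_prod_unfold)

text \<open>The same partitions with coefficients multiplied by \<open>c\<close> approximate the
  scaled integrand. The squared L2 distance gains the factor \<open>c^2\<close>, so the threshold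
  \<epsilon> corresponds to \<epsilon> / \<open>c^2\<close> for the original approximation.\<close>

lemma ito_integral_cmult:
  assumes c: "0 < c" and I: "ito_integral M F B H I"
  shows "ito_integral M F B (\<lambda>s \<omega>. c * H s \<omega>) (\<lambda>t \<omega>. c * I t \<omega>)"
proof -
  from I obtain n \<tau> \<xi> where simp: "\<And>k. simple_integrand F (n k) (\<tau> k) (\<xi> k)"
    and L2: "\<And>T \<epsilon>. 0 \<le> T \<Longrightarrow> 0 < \<epsilon> \<Longrightarrow> (\<lambda>k. measure M {\<omega>\<in>space M. ennreal \<epsilon> <
              (\<integral>\<^sup>+ s\<in>{0..T}. ennreal ((simple_process (n k) (\<tau> k) (\<xi> k) s \<omega> - H s \<omega>)\<^sup>2) \<partial>lborel)}) \<longlonglongrightarrow> 0"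
    and conv: "\<And>T. 0 \<le> T \<Longrightarrow> conv_in_prob M (\<lambda>k. simple_integral (n k) (\<tau> k) (\<xi> k) B T) (I T)"
    unfolding ito_integral_def by blast
  define \<xi>' where "\<xi>' = (\<lambda>k i \<omega>. c * \<xi> k i \<omega>)"
  have "simple_integrand F (n k) (\<tau> k) (\<xi>' k)" for k
    unfolding simple_integrand_def
  proof (intro conjI allI impI)
    fix i assume i: "i < n k"
    then obtain C where C: "\<And>\<omega>. \<omega>\<in>space (F (\<tau> k i)) \<Longrightarrow> \<bar>\<xi> k i \<omega>\<bar> \<le> C"
      using simp[of k] unfolding simple_integrand_def by blast
    show "\<exists>C. \<forall>\<omega>\<in>space (F (\<tau> k i)). \<bar>\<xi>' k i \<omega>\<bar> \<le> C"
      using C c by (intro exI[of _ "c * C"]) (auto simp: \<xi>'_def abs_mult intro!: mult_left_mono)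
  qed (use simp[of k] in \<open>auto simp: simple_integrand_def \<xi>'_def\<close>)
  moreover have "simple_integral (n k) (\<tau> k) (\<xi>' k) B T = (\<lambda>\<omega>. c * simple_integral (n k) (\<tau> k) (\<xi> k) B T \<omega>)" for k T
    by (simp add: simple_integral_def \<xi>'_def sum_distrib_left mult.assoc fun_eq_iff)
  then have "conv_in_prob M (\<lambda>k. simple_integral (n k) (\<tau> k) (\<xi>' k) B T) (\<lambda>\<omega>. c * I T \<omega>)"
    if "0 \<le> T" for T
    using conv_in_prob_cmult[OF c conv[OF that]] by simp
  moreover have "(\<lambda>k. measure M {\<omega>\<in>space M. ennreal \<epsilon> <
      (\<integral>\<^sup>+ s\<in>{0..T}. ennreal ((simple_process (n k) (\<tau> k) (\<xi>' k) s \<omega> - c * H s \<omega>)\<^sup>2) \<partial>lborel)}) \<longlonglongrightarrow> 0"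
    if "0 \<le> T" "0 < \<epsilon>" for T \<epsilon>
  proof -
    have "simple_process (n k) (\<tau> k) (\<xi>' k) s \<omega> - c * H s \<omega> =
        c * (simple_process (n k) (\<tau> k) (\<xi> k) s \<omega> - H s \<omega>)" for k s \<omega>
      by (simp only: simple_process_def \<xi>'_def sum_distrib_left mult.assoc right_diff_distrib)
    then have "(\<integral>\<^sup>+ s\<in>{0..T}. ennreal ((simple_process (n k) (\<tau> k) (\<xi>' k) s \<omega> - c * H s \<omega>)\<^sup>2) \<partial>lborel) =
        ennreal (c\<^sup>2) * (\<integral>\<^sup>+ s\<in>{0..T}. ennreal ((simple_process (n k) (\<tau> k) (\<xi> k) s \<omega> - H s \<omega>)\<^sup>2) \<partial>lborel)"
      for k \<omega>
      using c by (simp add: power_mult_distrib ennreal_mult mult.assoc flip: nn_integral_cmult_pos)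
    \<comment> \<open>The squared L2 distance may be infinite, so the threshold is moved across the
      factor in the extended reals, with infinity as a separate case.\<close>
    moreover have "ennreal \<epsilon> < ennreal (c\<^sup>2) * z \<longleftrightarrow> ennreal (\<epsilon> / c\<^sup>2) < z" for z
    proof (cases z)
      case (real r)
      then show ?thesis
        using c that
        by (simp add: ennreal_mult[symmetric] ennreal_less_iff pos_divide_less_eq mult.commute)
    qed (use c in \<open>simp add: ennreal_mult_top\<close>)
    ultimately show ?thesis
      using L2[OF that(1), of "\<epsilon> / c\<^sup>2"] c that by simp
  qed
  moreover have "adapted F (\<lambda>t \<omega>. c * I t \<omega>)" "continuous_paths M (\<lambda>t \<omega>. c * I t \<omega>)"
    using I by (auto simp: ito_integral_def adapted_cmult continuous_paths_def intro!: continuous_intros)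
  ultimately show ?thesis
    unfolding ito_integral_def by blast
qed

section \<open>Scaling of wealth paths and of their dynamics\<close>

lemma cadlag_cmult:
  assumes "cadlag M X"
  shows "cadlag M (\<lambda>t \<omega>. c * X t \<omega>)"
  unfolding cadlag_def
proof (intro ballI conjI allI impI)
  fix \<omega> t assume \<omega>: "\<omega> \<in> space M"
  show "continuous (at_right t) (\<lambda>s. c * X s \<omega>)" if "0 \<le> t"
    using assms \<omega> that by (auto simp: cadlag_def intro!: continuous_intros)
  show "\<exists>l. ((\<lambda>s. c * X s \<omega>) \<longlongrightarrow> l) (at_left t)" if pos: "0 < t"
  proof -
    obtain l where "((\<lambda>s. X s \<omega>) \<longlongrightarrow> l) (at_left t)"
      using assms \<omega> pos unfolding cadlag_def by blast
    then show ?thesis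
      by (intro exI) (rule tendsto_mult_left)
  qed
qed

text \<open>Only inside \<open>space M\<close>: \<open>Lim\<close> of a divergent path is an arbitrary number, which does not scale.\<close>

lemma left_limit_cmult:
  assumes "cadlag M X" "\<omega> \<in> space M"
  shows "left_limit (\<lambda>t \<omega>. c * X t \<omega>) t \<omega> = c * left_limit X t \<omega>"
proof (cases "t \<le> 0")
  case False
  then obtain l where l: "((\<lambda>s. X s \<omega>) \<longlongrightarrow> l) (at_left t)"
    using assms unfolding cadlag_def by fastforce
  then have "((\<lambda>s. c * X s \<omega>) \<longlongrightarrow> c * l) (at_left t)"
    by (rule tendsto_mult_left)
  with l show ?thesis
    using False by (simp add: left_limit_def tendsto_Lim)
qed (simp add: left_limit_def)

text \<open>The hypothesis concerns a single outcome, because left limits are known to scale only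
  for outcomes in the probability space.\<close>

lemma jump_sum_cmult:
  assumes "\<And>s. Y s \<omega> = c * X s \<omega>"
  shows "jump_sum L \<theta> N Y t \<omega> = c * jump_sum L \<theta> N X t \<omega>"
  using assms by (simp add: jump_sum_def sum_distrib_left mult.assoc distrib_left)

text \<open>The position grows through the number \<open>n\<close> of pool units, not through the
  depth. The control, and with it reserves per unit, fee rate per unit and jump returns, stays
  fixed, while outside holding, units, debt, fee rate and Ito part are all multiplied by
  \<open>c\<close>.\<close>

lemma lp_wealth_dynamics_scale:
  assumes ax: "lp_model_axioms L" and c: "0 < c" and dyn: "lp_wealth_dynamics L w \<theta> N W"
  shows "lp_wealth_dynamics L (c * w) \<theta> N (\<lambda>t \<omega>. c * W t \<omega>)"
proof -
  let ?M = "pspace L"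
  have prob: "prob_space ?M" and sub: "\<And>t. 0 < t \<Longrightarrow> subalgebra ?M (filt_before ?M (filt L) t)"
    using ax by (auto simp: lp_model_axioms_def regular_cond_prob_def Let_def)
  \<comment> \<open>These expressions take the existentially bound holdings as arguments, so that
    the dynamics can be instantiated both with the given holdings and with the scaled ones.\<close>
  define RA where "RA = (\<lambda>n t \<omega>. n t \<omega> * reserve_A (depth L (\<theta> t \<omega>)) (pool_price L t \<omega>))"
  define VAMM where "VAMM = (\<lambda>n t \<omega>. n t \<omega> * pool_value L t \<omega> (\<theta> t \<omega>))"
  define drift where "drift = (\<lambda>A n D Fdot t \<omega>. (A t \<omega> + RA n t \<omega>) * (mu L * ext_price L t \<omega>)
                            - borrow_rate L t \<omega> * D t \<omega> + Fdot t \<omega>)"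
  have unfold_dyn: "lp_wealth_dynamics L w \<theta> N W \<longleftrightarrow> (\<exists>A n D Fdot I.
        predictable ?M (filt L) A \<and> predictable ?M (filt L) n \<and> predictable ?M (filt L) D \<and>
        (\<forall>t\<ge>0. Fdot t \<in> borel_measurable ?M) \<and>
        (\<forall>t>0. AE \<omega> in ?M.
           real_cond_exp ?M (filt_before ?M (filt L) t) (Fdot t) \<omega> = n t \<omega> * noise_fee_rate L t \<omega> (\<theta> t \<omega>)) \<and>
        ito_integral ?M (filt L) (BM L)
          (\<lambda>s \<omega>. (A s \<omega> + RA n s \<omega>) * (sqrt (variance L s \<omega>) * ext_price L s \<omega>)) I \<and>
            (AE \<omega> in ?M. \<forall>t\<ge>0. set_integrable lborel {0..t} (\<lambda>s. drift A n D Fdot s \<omega>) \<and>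
               W t \<omega> = w + (LBINT s:{0..t}. drift A n D Fdot s \<omega>) + I t \<omega> + jump_sum L \<theta> N (VAMM n) t \<omega>))"
    for w and W :: "'a process"
    unfolding lp_wealth_dynamics_def RA_def VAMM_def drift_def Let_def by (rule refl)
  define sc :: "'a process \<Rightarrow> 'a process" where "sc = (\<lambda>X t \<omega>. c * X t \<omega>)"
  from dyn obtain A n D Fdot I where
    pred: "predictable ?M (filt L) A" "predictable ?M (filt L) n" "predictable ?M (filt L) D"
    and F: "\<And>t. 0 \<le> t \<Longrightarrow> Fdot t \<in> borel_measurable ?M"
    and ce: "\<And>t. 0 < t \<Longrightarrow> AE \<omega> in ?M.
           real_cond_exp ?M (filt_before ?M (filt L) t) (Fdot t) \<omega> = n t \<omega> * noise_fee_rate L t \<omega> (\<theta> t \<omega>)"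
    and ito: "ito_integral ?M (filt L) (BM L)
          (\<lambda>s \<omega>. (A s \<omega> + RA n s \<omega>) * (sqrt (variance L s \<omega>) * ext_price L s \<omega>)) I"
    and W: "AE \<omega> in ?M. \<forall>t\<ge>0. set_integrable lborel {0..t} (\<lambda>s. drift A n D Fdot s \<omega>) \<and>
               W t \<omega> = w + (LBINT s:{0..t}. drift A n D Fdot s \<omega>) + I t \<omega> + jump_sum L \<theta> N (VAMM n) t \<omega>"
    unfolding unfold_dyn by blast
  have RA_sc: "RA (sc n) s \<omega> = c * RA n s \<omega>"
    and drift_sc: "drift (sc A) (sc n) (sc D) (sc Fdot) s \<omega> = c * drift A n D Fdot s \<omega>" for s \<omega>
    by (auto simp: RA_def sc_def drift_def algebra_simps)
  have "AE \<omega> in ?M. real_cond_exp ?M (filt_before ?M (filt L) t) (sc Fdot t) \<omega> =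
      sc n t \<omega> * noise_fee_rate L t \<omega> (\<theta> t \<omega>)" if "0 < t" for t
  proof -
    interpret finite_measure_subalgebra ?M "filt_before ?M (filt L) t"
      using prob sub[OF that]
      by (simp add: finite_measure_subalgebra_def finite_measure_subalgebra_axioms_def prob_space.finite_measure)
    from real_cond_exp_cmult_pos[OF c F] ce that have
      "AE \<omega> in ?M. real_cond_exp ?M (filt_before ?M (filt L) t) (\<lambda>\<omega>. c * Fdot t \<omega>) \<omega> =
         c * real_cond_exp ?M (filt_before ?M (filt L) t) (Fdot t) \<omega>" by simp
    with ce[OF that] show ?thesis
      by eventually_elim (simp add: sc_def)
  qed
  moreover have "(\<lambda>s \<omega>. c * ((A s \<omega> + RA n s \<omega>) * (sqrt (variance L s \<omega>) * ext_price L s \<omega>))) =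
      (\<lambda>s \<omega>. (sc A s \<omega> + RA (sc n) s \<omega>) * (sqrt (variance L s \<omega>) * ext_price L s \<omega>))"
    unfolding RA_sc by (simp add: sc_def algebra_simps)
  then have "ito_integral ?M (filt L) (BM L)
      (\<lambda>s \<omega>. (sc A s \<omega> + RA (sc n) s \<omega>) * (sqrt (variance L s \<omega>) * ext_price L s \<omega>)) (sc I)"
    using ito_integral_cmult[OF c ito] by (simp add: sc_def)
  moreover have jump: "jump_sum L \<theta> N (VAMM (sc n)) t \<omega> = c * jump_sum L \<theta> N (VAMM n) t \<omega>" for t \<omega>
    by (rule jump_sum_cmult) (simp add: VAMM_def sc_def)
  from W have "AE \<omega> in ?M. \<forall>t\<ge>0.
      set_integrable lborel {0..t} (\<lambda>s. drift (sc A) (sc n) (sc D) (sc Fdot) s \<omega>) \<and>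
      sc W t \<omega> = c * w + (LBINT s:{0..t}. drift (sc A) (sc n) (sc D) (sc Fdot) s \<omega>) + sc I t \<omega>
        + jump_sum L \<theta> N (VAMM (sc n)) t \<omega>"
    unfolding drift_sc jump
    by eventually_elim (auto simp: sc_def distrib_left)
  moreover have "predictable ?M (filt L) (sc A)" "predictable ?M (filt L) (sc n)"
    "predictable ?M (filt L) (sc D)" "\<forall>t\<ge>0. sc Fdot t \<in> borel_measurable ?M"
    using pred F by (auto simp: sc_def predictable_cmult)
  ultimately have "lp_wealth_dynamics L (c * w) \<theta> N (sc W)"
    unfolding unfold_dyn by blast
  then show ?thesis by (simp add: sc_def)
qed

lemma proportional_dynamics_scale:
  assumes c: "0 < c" and cadlag: "cadlag (pspace L) W" and dyn: "proportional_dynamics L w \<theta> N W"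
  shows "proportional_dynamics L (c * w) \<theta> N (\<lambda>t \<omega>. c * W t \<omega>)"
proof -
  let ?M = "pspace L" and ?cW = "\<lambda>t \<omega>. c * W t \<omega>"
  have ll: "left_limit ?cW s \<omega> = c * left_limit W s \<omega>" if "\<omega> \<in> space ?M" for s \<omega>
    using cadlag that by (rule left_limit_cmult)
  from dyn obtain I where
    ito: "ito_integral ?M (filt L) (BM L) (\<lambda>s \<omega>. left_limit W s \<omega> * sqrt (variance L s \<omega>)) I"
    and W: "AE \<omega> in ?M. \<forall>t\<ge>0.
        set_integrable lborel {0..t} (\<lambda>s. left_limit W s \<omega> * wealth_drift L s \<omega> (\<theta> s \<omega>)) \<and>
        W t \<omega> = w + (LBINT s:{0..t}. left_limit W s \<omega> * wealth_drift L s \<omega> (\<theta> s \<omega>)) + I t \<omega> +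
          jump_sum L \<theta> N (\<lambda>s \<omega>. left_limit W s \<omega> * \<theta> s \<omega>) t \<omega>"
    unfolding proportional_dynamics_def Let_def by blast
  \<comment> \<open>The identity for left limits is available only on the probability space, and
    \<open>ito_integral\<close> evaluates its integrand only there.\<close>
  have "ito_integral ?M (filt L) (BM L) (\<lambda>s \<omega>. left_limit ?cW s \<omega> * sqrt (variance L s \<omega>)) (\<lambda>t \<omega>. c * I t \<omega>)"
    using ito_integral_cmult[OF c ito]
    unfolding ito_integral_def by (simp add: ll mult.assoc cong: conj_cong)
  moreover from W have "AE \<omega> in ?M. \<forall>t\<ge>0.
        set_integrable lborel {0..t} (\<lambda>s. left_limit ?cW s \<omega> * wealth_drift L s \<omega> (\<theta> s \<omega>)) \<and>
        ?cW t \<omega> = c * w + (LBINT s:{0..t}. left_limit ?cW s \<omega> * wealth_drift L s \<omega> (\<theta> s \<omega>)) + c * I t \<omega> +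
          jump_sum L \<theta> N (\<lambda>s \<omega>. left_limit ?cW s \<omega> * \<theta> s \<omega>) t \<omega>"
  proof (rule AE_mp, intro AE_I2 impI)
    fix \<omega> assume \<omega>: "\<omega> \<in> space ?M" and *: "\<forall>t\<ge>0.
        set_integrable lborel {0..t} (\<lambda>s. left_limit W s \<omega> * wealth_drift L s \<omega> (\<theta> s \<omega>)) \<and>
        W t \<omega> = w + (LBINT s:{0..t}. left_limit W s \<omega> * wealth_drift L s \<omega> (\<theta> s \<omega>)) + I t \<omega> +
          jump_sum L \<theta> N (\<lambda>s \<omega>. left_limit W s \<omega> * \<theta> s \<omega>) t \<omega>"
    have "jump_sum L \<theta> N (\<lambda>s \<omega>. left_limit ?cW s \<omega> * \<theta> s \<omega>) t \<omega> =
        c * jump_sum L \<theta> N (\<lambda>s \<omega>. left_limit W s \<omega> * \<theta> s \<omega>) t \<omega>" for t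
      by (rule jump_sum_cmult) (simp add: ll[OF \<omega>])
    with * show "\<forall>t\<ge>0.
        set_integrable lborel {0..t} (\<lambda>s. left_limit ?cW s \<omega> * wealth_drift L s \<omega> (\<theta> s \<omega>)) \<and>
        ?cW t \<omega> = c * w + (LBINT s:{0..t}. left_limit ?cW s \<omega> * wealth_drift L s \<omega> (\<theta> s \<omega>)) + c * I t \<omega> +
          jump_sum L \<theta> N (\<lambda>s \<omega>. left_limit ?cW s \<omega> * \<theta> s \<omega>) t \<omega>"
      by (simp add: ll[OF \<omega>] mult.assoc distrib_left)
  qed
  ultimately show ?thesis
    unfolding proportional_dynamics_def Let_def by blast
qed

text \<open>The same counting processes serve as witnesses, since \<open>correction_process\<close>
  depends on the control but not on wealth.\<close>

lemma controlled_wealth_scale: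
  assumes ax: "lp_model_axioms L" and c: "0 < c" and W: "controlled_wealth L w \<theta> W"
  shows "controlled_wealth L (c * w) \<theta> (\<lambda>t \<omega>. c * W t \<omega>)"
proof -
  from W have *: "control L \<theta>" "adapted (filt L) W" "cadlag (pspace L) W"
    "\<forall>\<omega>\<in>space (pspace L). \<forall>t\<ge>0. 0 < W t \<omega>"
    by (auto simp: controlled_wealth_def)
  from W obtain N where "\<forall>sd. correction_process L \<theta> sd (N sd)"
    "lp_wealth_dynamics L w \<theta> N W" "proportional_dynamics L w \<theta> N W"
    by (auto simp: controlled_wealth_def)
  with lp_wealth_dynamics_scale[OF ax c] proportional_dynamics_scale[OF c *(3)]
  have "\<exists>N. (\<forall>sd. correction_process L \<theta> sd (N sd)) \<and>
      lp_wealth_dynamics L (c * w) \<theta> N (\<lambda>t \<omega>. c * W t \<omega>) \<and>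
      proportional_dynamics L (c * w) \<theta> N (\<lambda>t \<omega>. c * W t \<omega>)"
    by blast
  with * c show ?thesis
    by (simp add: controlled_wealth_def adapted_cmult cadlag_cmult)
qed

section \<open>Scaling of utility and power form of the value function\<close>

lemma expected_utility_scale:
  assumes c: "0 < c" and W: "\<And>\<omega> t. \<omega> \<in> space (pspace L) \<Longrightarrow> 0 \<le> t \<Longrightarrow> 0 < W t \<omega>"
  shows "expected_utility L (\<lambda>t \<omega>. c * W t \<omega>) = ereal (c powr (1 - eta L)) * expected_utility L W"
proof -
  let ?k = "c powr (1 - eta L)"
  let ?u = "\<lambda>W \<omega>. \<integral>\<^sup>+ t\<in>{0..}. ennreal (exp (- rho L * t) * W t \<omega> powr (1 - eta L)) \<partial>lborel"
  have "?u (\<lambda>t \<omega>. c * W t \<omega>) \<omega> = ennreal ?k * ?u W \<omega>" if "\<omega> \<in> space (pspace L)" for \<omega>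
  proof -
    have "?u (\<lambda>t \<omega>. c * W t \<omega>) \<omega> =
        (\<integral>\<^sup>+ t. ennreal ?k * (ennreal (exp (- rho L * t) * W t \<omega> powr (1 - eta L)) * indicator {0..} t) \<partial>lborel)"
    proof (rule nn_integral_cong)
      fix t :: real
      show "ennreal (exp (- rho L * t) * (c * W t \<omega>) powr (1 - eta L)) * indicator {0..} t =
          ennreal ?k * (ennreal (exp (- rho L * t) * W t \<omega> powr (1 - eta L)) * indicator {0..} t)"
        using c W[OF that, of t] by (cases "0 \<le> t")
          (auto simp: powr_mult ennreal_mult[symmetric] ac_simps)
    qed
    then show ?thesis
      using c by (simp add: nn_integral_cmult_pos)
  qed
  then have "(\<integral>\<^sup>+ \<omega>. ?u (\<lambda>t \<omega>. c * W t \<omega>) \<omega> \<partial>pspace L) = (\<integral>\<^sup>+ \<omega>. ennreal ?k * ?u W \<omega> \<partial>pspace L)"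
    by (intro nn_integral_cong)
  also have "\<dots> = ennreal ?k * (\<integral>\<^sup>+ \<omega>. ?u W \<omega> \<partial>pspace L)"
    using c by (intro nn_integral_cmult_pos) simp
  finally show ?thesis
    unfolding expected_utility_def
    by (simp add: times_ennreal.rep_eq enn2ereal_ennreal ac_simps)
qed

text \<open>Dividing wealth by \<open>d\<close> turns every competitor from \<open>d * w\<close>
  into one from \<open>w\<close>, which gives one inequality for all positive factors. Applied to
  \<open>1 / c\<close> at \<open>c * w\<close> it gives the other. The argument also covers infinite
  values and an empty set of competitors.\<close>

lemma value_function_scale:
  assumes ax: "lp_model_axioms L" and c: "0 < c"
  shows "value_function L (c * w) = ereal (c powr (1 - eta L)) * value_function L w"
proof -
  have le: "value_function L (d * w) \<le> ereal (d powr (1 - eta L)) * value_function L w"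
    if d: "0 < d" for d w
    unfolding value_function_def[of L "d * w"]
  proof (rule SUP_least, safe)
    fix \<theta> W assume W: "controlled_wealth L (d * w) \<theta> W"
    have "controlled_wealth L (1 / d * (d * w)) \<theta> (\<lambda>t \<omega>. 1 / d * W t \<omega>)"
      using controlled_wealth_scale[OF ax _ W, of "1 / d"] d by simp
    then have "controlled_wealth L w \<theta> (\<lambda>t \<omega>. 1 / d * W t \<omega>)"
      using d by simp
    then have "expected_utility L (\<lambda>t \<omega>. 1 / d * W t \<omega>) \<le> value_function L w"
      unfolding value_function_def by (intro SUP_upper2[of "(\<theta>, \<lambda>t \<omega>. 1 / d * W t \<omega>)"]) auto
    then have "ereal (d powr (1 - eta L)) * expected_utility L (\<lambda>t \<omega>. 1 / d * W t \<omega>)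
        \<le> ereal (d powr (1 - eta L)) * value_function L w"
      by (intro ereal_mult_left_mono) auto
    moreover have "ereal (d powr (1 - eta L)) * expected_utility L (\<lambda>t \<omega>. 1 / d * W t \<omega>) = expected_utility L W"
      using expected_utility_scale[of d L "\<lambda>t \<omega>. 1 / d * W t \<omega>"] W d
      by (simp add: controlled_wealth_def)
    ultimately show "expected_utility L W \<le> ereal (d powr (1 - eta L)) * value_function L w"
      by simp
  qed
  show ?thesis
  proof (rule antisym)
    show "value_function L (c * w) \<le> ereal (c powr (1 - eta L)) * value_function L w"
      using c by (rule le)
    have "value_function L w \<le> ereal ((1 / c) powr (1 - eta L)) * value_function L (c * w)"
      using le[of "1 / c" "c * w"] c by simp
    then have "ereal (c powr (1 - eta L)) * value_function L w \<le>
        ereal (c powr (1 - eta L)) * (ereal ((1 / c) powr (1 - eta L)) * value_function L (c * w))"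
      by (intro ereal_mult_left_mono) auto
    also have "\<dots> = value_function L (c * w)"
      using c by (simp add: mult.assoc[symmetric] powr_mult[symmetric])
    finally show "ereal (c powr (1 - eta L)) * value_function L w \<le> value_function L (c * w)" .
  qed
qed

text \<open>The sign is that of \<open>1 / (1 - eta L)\<close>, as the remaining factor of the
  utility is a nonnegative integral. The value minus infinity arises for \<open>eta L < 1\<close> as
  the supremum over an empty set of controlled wealth processes.\<close>

lemma value_function_sign:
  "eta L < 1 \<Longrightarrow> value_function L w = -\<infinity> \<or> 0 \<le> value_function L w"
  "1 < eta L \<Longrightarrow> value_function L w \<le> 0"
proof -
  show "value_function L w = -\<infinity> \<or> 0 \<le> value_function L w" if "eta L < 1"
  proof (cases "\<exists>\<theta> W. controlled_wealth L w \<theta> W")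
    case True
    then obtain \<theta> W where "controlled_wealth L w \<theta> W" by blast
    moreover have "0 \<le> expected_utility L W"
      using that by (simp add: expected_utility_def)
    ultimately show ?thesis
      unfolding value_function_def by (intro disjI2 SUP_upper2[of "(\<theta>, W)"]) auto
  qed (simp add: value_function_def bot_ereal_def)
  show "value_function L w \<le> 0" if "1 < eta L"
    unfolding value_function_def expected_utility_def
    using that by (intro SUP_least) (auto simp: ereal_zero_le_0_iff mult_le_0_iff ereal_mult_le_0_iff)
qed

lemma value_function_crra:
  assumes ax: "lp_model_axioms L" and V: "value_function L 1 \<noteq> 0" "\<bar>value_function L 1\<bar> \<noteq> \<infinity>"
  obtains A where "0 < A" "\<And>w y. 0 < w \<Longrightarrow> value_function L w = ereal (crra_value (eta L) (\<lambda>_. A) w y)"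
proof -
  from V obtain r where r: "value_function L 1 = ereal r" "r \<noteq> 0"
    by (cases "value_function L 1") auto
  have eta: "eta L \<noteq> 1"
    using ax by (simp add: lp_model_axioms_def Let_def)
  show thesis
  \<comment> \<open>The coefficient is forced by wealth 1, where \<open>crra_value\<close> equals
    the coefficient divided by \<open>1 - eta L\<close>.\<close>
  proof (rule that[of "r * (1 - eta L)"])
    show "0 < r * (1 - eta L)"
      using value_function_sign[of L 1] r eta by (cases "eta L < 1") (auto simp: zero_less_mult_iff)
    show "value_function L w = ereal (crra_value (eta L) (\<lambda>_. r * (1 - eta L)) w y)" if "0 < w" for w y
      using value_function_scale[OF ax that, of 1] r eta by (simp add: crra_value_def)
  qed
qed

text \<open>By homogeneity the value function is a power function on each half-line; the values at negative
  wealth are irrelevant, but measurability is needed on the whole line.\<close>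

lemma borel_measurable_value_function:
  assumes ax: "lp_model_axioms L"
  shows "(\<lambda>w. real_of_ereal (value_function L w)) \<in> borel_measurable borel"
proof -
  let ?v = "\<lambda>w. real_of_ereal (value_function L w)"
  have "?v w = (if 0 < w then w powr (1 - eta L) * ?v 1
      else if w < 0 then (- w) powr (1 - eta L) * ?v (- 1) else ?v 0)" for w
    using value_function_scale[OF ax, of w 1] value_function_scale[OF ax, of "- w" "- 1"] by auto
  then have eq: "?v = (\<lambda>w. if 0 < w then w powr (1 - eta L) * ?v 1
      else if w < 0 then (- w) powr (1 - eta L) * ?v (- 1) else ?v 0)" by blast
  show ?thesis
    by (subst eq) measurable
qed


section \<open>The HJB objective at a CRRA value function\<close>

lemma SUP_ereal_affine:
  assumes "0 < c"
  shows "(SUP i\<in>I. ereal (a + c * f i)) = ereal a + ereal c * (SUP i\<in>I. ereal (f i))"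
\<comment> \<open>Over the empty set both sides are minus infinity, the right one because
  \<open>c\<close> is positive.\<close>
proof (cases "I = {}")
  case False
  then show ?thesis
    using assms by (simp add: Sup_ereal_mult_left' flip: SUP_ereal_add_right)
qed (use assms in \<open>simp add: bot_ereal_def\<close>)

lemma is_arg_max_affine:
  fixes f g :: "'b \<Rightarrow> real"
  assumes "0 < c" "\<And>x. P x \<Longrightarrow> g x = a + c * f x"
  shows "is_arg_max g P x \<longleftrightarrow> is_arg_max f P x"
  using assms by (auto simp: is_arg_max_def)

text \<open>\<open>C2_on\<close> supplies some derivatives relative to \<open>S\<close>, whereas
  \<open>hjb_objective\<close> is written with \<open>deriv\<close>. On an open set they coincide,
  and they do so near \<open>y\<close>, which permits the second differentiation.\<close>

lemma C2_on_open_deriv: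
  assumes S: "open S" and y: "y \<in> S" and f: "C2_on S f"
  shows "(f has_real_derivative deriv f y) (at y)"
    and "(deriv f has_real_derivative (deriv ^^ 2) f y) (at y)"
proof -
  from f obtain f' f'' where f': "\<And>x. x \<in> S \<Longrightarrow> (f has_real_derivative f' x) (at x within S)"
    and f'': "\<And>x. x \<in> S \<Longrightarrow> (f' has_real_derivative f'' x) (at x within S)"
    unfolding C2_on_def by blast
  have D: "deriv f x = f' x" if "x \<in> S" for x
    using f'[OF that] at_within_open[OF that S] by (simp add: DERIV_imp_deriv)
  show "(f has_real_derivative deriv f y) (at y)"
    using f'[OF y] D[OF y] at_within_open[OF y S] by simp
  have "(deriv f has_real_derivative f'' y) (at y)"
    using f''[OF y] D at_within_open[OF y S]
    by (auto intro: has_field_derivative_transform_within_open[OF _ S y, of f'])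
  then show "(deriv f has_real_derivative (deriv ^^ 2) f y) (at y)"
    by (simp add: numeral_2_eq_2 DERIV_imp_deriv)
qed

text \<open>The power form is required at positive arguments only, which form a neighbourhood of
  \<open>w\<close>; the value function is used here and has this form only for positive
  wealth.\<close>

lemma
  fixes g :: "real \<Rightarrow> real"
  assumes "0 < w" "\<eta> \<noteq> 1" "\<And>x. 0 < x \<Longrightarrow> g x = k * (x powr (1 - \<eta>) / (1 - \<eta>))"
  shows deriv_crra: "deriv g w = k * w powr (- \<eta>)"
    and deriv2_crra: "(deriv ^^ 2) g w = - \<eta> * k * w powr (- \<eta> - 1)"
proof -
  have D: "deriv g x = k * x powr (- \<eta>)" if "0 < x" for x
  proof -
    have "((\<lambda>x. k * (x powr (1 - \<eta>) / (1 - \<eta>))) has_real_derivative k * x powr (- \<eta>)) (at x)"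
      using that assms(2) by (auto intro!: derivative_eq_intros)
    then show ?thesis
      using assms(3) that
      by (intro DERIV_imp_deriv)
        (auto intro: has_field_derivative_transform_within_open[where S = "{0<..}"])
  qed
  then show "deriv g w = k * w powr (- \<eta>)"
    using assms(1) by simp
  have "((\<lambda>x. k * x powr (- \<eta>)) has_real_derivative - \<eta> * k * w powr (- \<eta> - 1)) (at w)"
    using assms(1) by (auto intro!: derivative_eq_intros)
  then have "(deriv g has_real_derivative - \<eta> * k * w powr (- \<eta> - 1)) (at w)"
    using assms(1) D by (auto intro: has_field_derivative_transform_within_open[where S = "{0<..}"])
  then show "(deriv ^^ 2) g w = - \<eta> * k * w powr (- \<eta> - 1)"
    by (simp add: numeral_2_eq_2 DERIV_imp_deriv)
qed

section \<open>Jump expectations and evaluation of the generator\<close>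

lemma J_ext_measurable:
  assumes [measurable]: "m \<in> borel_measurable M" "u \<in> borel_measurable M"
  shows "(\<lambda>x. J_ext \<gamma> sd (m x) (u x)) \<in> borel_measurable M"
  by (cases sd) simp_all

lemma jump_ret_measurable:
  assumes "lp_model_axioms L" "0 < t"
  shows "jump_ret L sd t \<omega> \<theta> \<in> borel_measurable (pspace L)"
  using assms unfolding jump_ret_def lp_model_axioms_def Let_def by (intro J_ext_measurable) auto

lemma sets_cond_law:
  assumes "lp_model_axioms L" "0 < t" "\<omega> \<in> space (pspace L)"
  shows "sets (cond_law L t \<omega>) = sets (pspace L)"
proof -
  have "regular_cond_prob (pspace L) (filt_before (pspace L) (filt L) t) (cond_law L t)"
    using assms by (simp add: lp_model_axioms_def Let_def)
  then have "cond_law L t \<in> measurable (filt_before (pspace L) (filt L) t) (prob_algebra (pspace L))"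
    and "space (filt_before (pspace L) (filt L) t) = space (pspace L)"
    by (auto simp: regular_cond_prob_def subalgebra_def)
  then have "cond_law L t \<omega> \<in> space (prob_algebra (pspace L))"
    using assms(3) by (metis measurable_space)
  then show ?thesis
    by (simp add: space_prob_algebra)
qed

text \<open>\<open>U\<close> stands both for \<open>crra_value\<close> and for the value function
  itself, which agree only at positive wealth; hence the separate measurability hypothesis on the
  whole line.\<close>

lemma hjb_objective_crra:
  assumes ax: "lp_model_axioms L" and t: "0 < t" and \<omega>: "\<omega> \<in> space (pspace L)"
    and S: "open S" "variance L t \<omega> \<in> S" and f: "C2_on S f" and w: "0 < w"
    and U: "\<And>x z. 0 < x \<Longrightarrow> U x z = crra_value (eta L) f x z"
    and U_meas: "(\<lambda>x. U x (variance L t \<omega>)) \<in> borel_measurable borel"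
    and \<theta>: "\<theta> \<in> Theta_adm L t \<omega>"
  shows "hjb_objective L U t \<omega> w \<theta> =
    w powr (1 - eta L) / (1 - eta L) *
      (1 + kappa L * (vbar L - variance L t \<omega>) * deriv f (variance L t \<omega>)
         + 1 / 2 * (xi L)\<^sup>2 * variance L t \<omega> * (deriv ^^ 2) f (variance L t \<omega>))
    + f (variance L t \<omega>) * w powr (1 - eta L) * Phi L t \<omega> \<theta>"
proof -
  define \<eta> y where "\<eta> = eta L" and "y = variance L t \<omega>"
  have eta: "\<eta> \<noteq> 1"
    using ax by (simp add: lp_model_axioms_def Let_def \<eta>_def)
  have "variance_dynamics L"
    using ax by (simp add: lp_model_axioms_def Let_def)
  then have y: "0 \<le> y"
    using t \<omega> by (simp add: variance_dynamics_def Let_def y_def)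
  have Ux: "U x y = f y * (x powr (1 - \<eta>) / (1 - \<eta>))" if "0 < x" for x
    using U[OF that] by (simp add: crra_value_def \<eta>_def)
  have D: "deriv (\<lambda>x. U x y) w = f y * w powr (- \<eta>)"
    "(deriv ^^ 2) (\<lambda>x. U x y) w = - \<eta> * f y * w powr (- \<eta> - 1)"
    by (rule deriv_crra[OF w eta Ux] deriv2_crra[OF w eta Ux], assumption)+
  have Uw: "U w = (\<lambda>z. w powr (1 - \<eta>) / (1 - \<eta>) * f z)"
    using U[OF w] by (auto simp: crra_value_def \<eta>_def)
  define p where "p = w powr (1 - \<eta>) / (1 - \<eta>)"
  have fD: "(f has_real_derivative deriv f y) (at y)"
    and fDD: "(deriv f has_real_derivative (deriv ^^ 2) f y) (at y)"
    using C2_on_open_deriv[OF S f] by (simp_all add: y_def)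
  \<comment> \<open>The identity is proved throughout \<open>S\<close>, because
    \<open>deriv (U w)\<close> is differentiated once more below.\<close>
  have "deriv (\<lambda>z. p * f z) z = p * deriv f z" if "z \<in> S" for z
    using C2_on_open_deriv(1)[OF S(1) that f] by (intro DERIV_imp_deriv DERIV_cmult)
  then have E1: "deriv (U w) y = p * deriv f y"
    and ev: "\<forall>\<^sub>F z in nhds y. deriv (U w) z = p * deriv f z"
    using S by (auto simp: y_def Uw p_def[symmetric] eventually_nhds)
  have "deriv (deriv (U w)) y = deriv (\<lambda>z. p * deriv f z) y"
    by (rule deriv_cong_ev[OF ev refl])
  also have "\<dots> = p * (deriv ^^ 2) f y"
    using fDD by (intro DERIV_imp_deriv DERIV_cmult)
  finally have E2: "(deriv ^^ 2) (U w) y = p * (deriv ^^ 2) f y"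
    by (simp add: numeral_2_eq_2)
  \<comment> \<open>The factors \<open>w\<close> and \<open>w^2\<close> of the generator restore the
    powers lost in differentiation, so that every term carries
    \<open>w powr (1 - \<eta>)\<close>.\<close>
  have w1: "w * w powr (- \<eta>) = w powr (1 - \<eta>)" and w2: "w\<^sup>2 * w powr (- \<eta> - 1) = w powr (1 - \<eta>)"
    using w by (simp_all add: powr_add[symmetric] powr_diff powr_minus field_simps power2_eq_square)
  \<comment> \<open>Admissibility makes wealth after the jump positive only almost surely, and the
    form of \<open>U\<close> is known only there. The integrands agree almost everywhere, and
    measurability of \<open>U\<close> turns this into equality of integrals.\<close>
  have int: "(\<integral>\<omega>'. U (w + w * (\<theta> * jump_ret L sd t \<omega> \<theta> \<omega>')) y - U w y \<partial>cond_law L t \<omega>) =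
      f y * p * G_fun L sd t \<omega> \<theta>" for sd
  proof -
    note [measurable_cong] = sets_cond_law[OF ax t \<omega>]
    note [measurable] = jump_ret_measurable[OF ax t]
    have [measurable]: "(\<lambda>x. U x y) \<in> borel_measurable borel"
      using U_meas by (simp add: y_def)
    have "AE \<omega>' in cond_law L t \<omega>. 0 < 1 + \<theta> * jump_ret L sd t \<omega> \<theta> \<omega>'"
      using \<theta> by (simp add: Theta_adm_def)
    then have "AE \<omega>' in cond_law L t \<omega>. U (w + w * (\<theta> * jump_ret L sd t \<omega> \<theta> \<omega>')) y - U w y =
        f y * p * utility_gain L sd t \<omega> \<theta> \<omega>'"
    proof eventually_elim
      case (elim \<omega>')
      have eq: "w + w * (\<theta> * jump_ret L sd t \<omega> \<theta> \<omega>') = w * (1 + \<theta> * jump_ret L sd t \<omega> \<theta> \<omega>')"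
        by (simp add: algebra_simps)
      show ?case
        using w elim unfolding eq
        by (simp add: Ux powr_mult utility_gain_def \<eta>_def[symmetric] p_def right_diff_distrib)
    qed
    then have "(\<integral>\<omega>'. U (w + w * (\<theta> * jump_ret L sd t \<omega> \<theta> \<omega>')) y - U w y \<partial>cond_law L t \<omega>) =
        (\<integral>\<omega>'. f y * p * utility_gain L sd t \<omega> \<theta> \<omega>' \<partial>cond_law L t \<omega>)"
      by (intro integral_cong_AE) (simp_all add: utility_gain_def)
    then show ?thesis
      by (simp add: G_fun_def)
  qed
  have jump: "(\<Sum>sd\<in>{Buy, Sell}. intensity L sd \<theta> y * (f y * p * G_fun L sd t \<omega> \<theta>)) =
      f y * w powr (1 - \<eta>) *
        (\<Sum>sd\<in>{Buy, Sell}. intensity L sd \<theta> y / (1 - \<eta>) * G_fun L sd t \<omega> \<theta>)"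
    unfolding sum_distrib_left p_def by (rule sum.cong) (simp_all add: field_simps)
  have diffusion: "1 / 2 * (w * sqrt y)\<^sup>2 * (- \<eta> * f y * w powr (- \<eta> - 1)) =
      f y * w powr (1 - \<eta>) * (- (\<eta> / 2 * y))"
    using y by (simp add: power_mult_distrib w2[symmetric])
  have drift: "w * wealth_drift L t \<omega> \<theta> * (f y * w powr (- \<eta>)) =
      f y * w powr (1 - \<eta>) * wealth_drift L t \<omega> \<theta>"
    by (simp add: w1[symmetric])
  have "hjb_objective L U t \<omega> w \<theta> = p
      + w * wealth_drift L t \<omega> \<theta> * (f y * w powr (- \<eta>))
      + 1 / 2 * (w * sqrt y)\<^sup>2 * (- \<eta> * f y * w powr (- \<eta> - 1))
      + kappa L * (vbar L - y) * (p * deriv f y)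
      + 1 / 2 * (xi L * sqrt y)\<^sup>2 * (p * (deriv ^^ 2) f y)
      + (\<Sum>sd\<in>{Buy, Sell}. intensity L sd \<theta> y * (f y * p * G_fun L sd t \<omega> \<theta>))"
    unfolding hjb_objective_def Let_def y_def[symmetric] int E1 E2 D
    by (simp only: \<eta>_def[symmetric] p_def)
  also have "\<dots> = p * (1 + kappa L * (vbar L - y) * deriv f y + 1 / 2 * (xi L)\<^sup>2 * y * (deriv ^^ 2) f y)
      + f y * w powr (1 - \<eta>) * Phi L t \<omega> \<theta>"
    unfolding jump diffusion drift
    unfolding Phi_def wealth_drift_def \<eta>_def[symmetric] y_def[symmetric]
    using y by (simp add: power_mult_distrib algebra_simps)
  finally show ?thesis
    by (simp add: p_def \<eta>_def y_def)
qed

section \<open>The derivative of the pointwise objective\<close>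

text \<open>\<open>vector_derivative\<close> is a choice among all derivatives, and the choice is
  unique only at a limit point of \<open>S\<close>.\<close>

lemma C2_on_deriv_within:
  assumes "C2_on S f" "x \<in> S" "at x within S \<noteq> bot"
  shows "(f has_real_derivative deriv_within S f x) (at x within S)"
proof -
  from assms obtain D where D: "(f has_real_derivative D) (at x within S)"
    unfolding C2_on_def by blast
  then show ?thesis
    using vector_derivative_within[OF assms(3), of f D]
    by (simp add: has_real_derivative_iff_has_vector_derivative)
qed

text \<open>All derivatives are relative to \<open>Theta_adm\<close>, so end points are covered by
  one-sided derivatives. The power rule yields the factor \<open>1 - eta L\<close>, which cancels
  the denominator in \<open>Phi\<close> and leaves \<open>H_fun\<close>.\<close>

lemma Phi_has_derivative:
  assumes ax: "lp_model_axioms L" and A2: "assumption_A2 L t \<omega>" and \<theta>: "\<theta> \<in> Theta_adm L t \<omega>"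
  shows "(Phi L t \<omega> has_real_derivative Phi_prime L t \<omega> \<theta>) (at \<theta> within Theta_adm L t \<omega>)"
proof (cases "at \<theta> within Theta_adm L t \<omega> = bot")
  case True \<comment> \<open>isolated point: every number is a derivative, and \<open>deriv_within\<close> is arbitrary\<close>
  then show ?thesis
    by (simp add: has_field_derivative_iff)
next
  case nontriv: False
  let ?S = "Theta_adm L t \<omega>" and ?y = "variance L t \<omega>" and ?k = "cond_law L t \<omega>"
  have eta: "eta L \<noteq> 1"
    using ax by (simp add: lp_model_axioms_def Let_def)
  have \<psi>: "(noise_yield L t \<omega> has_real_derivative deriv_within ?S (noise_yield L t \<omega>) \<theta>) (at \<theta> within ?S)"
    and \<lambda>: "\<And>sd. ((\<lambda>\<theta>. intensity L sd \<theta> ?y) has_real_derivative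
        deriv_within ?S (\<lambda>\<theta>. intensity L sd \<theta> ?y) \<theta>) (at \<theta> within ?S)"
    using A2 \<theta> nontriv by (auto simp: assumption_A2_def Let_def intro!: C2_on_deriv_within)
  have G: "(G_fun L sd t \<omega> has_real_derivative (1 - eta L) * H_fun L sd t \<omega> \<theta>) (at \<theta> within ?S)" for sd
  proof -
    have C2: "AE \<omega>' in ?k. C2_on ?S (\<lambda>\<theta>. jump_ret L sd t \<omega> \<theta> \<omega>')"
      and du: "integrable ?k (H_integrand L sd t \<omega> \<theta>)"
        "integrable ?k (\<lambda>\<omega>'. deriv_within ?S (\<lambda>\<theta>. utility_gain L sd t \<omega> \<theta> \<omega>') \<theta>)"
      and GD: "(G_fun L sd t \<omega> has_real_derivative
           (\<integral>\<omega>'. deriv_within ?S (\<lambda>\<theta>. utility_gain L sd t \<omega> \<theta> \<omega>') \<theta> \<partial>?k)) (at \<theta> within ?S)"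
      using A2 \<theta> by (auto simp: assumption_A2_def diff_under_expectation_def Let_def)
    have "AE \<omega>' in ?k. 0 < 1 + \<theta> * jump_ret L sd t \<omega> \<theta> \<omega>'"
      using \<theta> by (simp add: Theta_adm_def)
    \<comment> \<open>The chain rule for the power needs a positive base and a differentiable jump
      return; both hold outside a null set.\<close>
    with C2 have "AE \<omega>' in ?k. deriv_within ?S (\<lambda>\<theta>. utility_gain L sd t \<omega> \<theta> \<omega>') \<theta> =
        (1 - eta L) * H_integrand L sd t \<omega> \<theta> \<omega>'"
    proof eventually_elim
      case (elim \<omega>')
      have "((\<lambda>\<theta>. jump_ret L sd t \<omega> \<theta> \<omega>') has_real_derivative
          deriv_within ?S (\<lambda>\<theta>. jump_ret L sd t \<omega> \<theta> \<omega>') \<theta>) (at \<theta> within ?S)"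
        using elim(1) \<theta> nontriv by (rule C2_on_deriv_within)
      then have "((\<lambda>\<theta>. utility_gain L sd t \<omega> \<theta> \<omega>') has_real_derivative
          (1 - eta L) * H_integrand L sd t \<omega> \<theta> \<omega>') (at \<theta> within ?S)"
        unfolding utility_gain_def H_integrand_def
        using elim(2) by (auto intro!: derivative_eq_intros simp: algebra_simps)
      then show ?case
        by (intro vector_derivative_within nontriv) (simp add: has_real_derivative_iff_has_vector_derivative)
    qed
    then have "(\<integral>\<omega>'. deriv_within ?S (\<lambda>\<theta>. utility_gain L sd t \<omega> \<theta> \<omega>') \<theta> \<partial>?k) =
        (\<integral>\<omega>'. (1 - eta L) * H_integrand L sd t \<omega> \<theta> \<omega>' \<partial>?k)"
      using du by (intro integral_cong_AE) auto
    with GD show ?thesis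
      by (simp add: H_fun_def)
  qed
  have summand: "((\<lambda>\<theta>. intensity L sd \<theta> ?y / (1 - eta L) * G_fun L sd t \<omega> \<theta>) has_real_derivative
      intensity L sd \<theta> ?y * H_fun L sd t \<omega> \<theta>
        + deriv_within ?S (\<lambda>\<theta>. intensity L sd \<theta> ?y) \<theta> / (1 - eta L) * G_fun L sd t \<omega> \<theta>) (at \<theta> within ?S)" for sd
    using DERIV_mult[OF DERIV_cdivide[OF \<lambda>[of sd], of "1 - eta L"] G[of sd]] eta
    by (simp add: ac_simps)
  have lin: "((\<lambda>\<theta>. mu L - borrow_rate L t \<omega> * \<theta> - eta L / 2 * ?y + \<theta> * noise_yield L t \<omega> \<theta>) has_real_derivative
      - borrow_rate L t \<omega> + noise_yield L t \<omega> \<theta> + \<theta> * deriv_within ?S (noise_yield L t \<omega>) \<theta>) (at \<theta> within ?S)"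
    by (rule derivative_eq_intros \<psi> refl | simp)+
  show ?thesis
    unfolding Phi_def[abs_def] Phi_prime_def Let_def
    by (intro DERIV_add lin DERIV_sum summand)
qed

section \<open>Maximization of strictly concave functions on an interval\<close>

text \<open>A limit of difference quotients yields only a weak inequality, here
  \<open>f m - f x \<le> D * (m - x)\<close> at the midpoint \<open>m\<close>. Strict concavity at
  \<open>m\<close> gives \<open>f z - f x < 2 * (f m - f x)\<close> and thereby strictness.\<close>

lemma strictly_concave_on_tangent:
  assumes f: "strictly_concave_on S f" and x: "x \<in> S" and z: "z \<in> S" "x \<noteq> z"
    and D: "(f has_real_derivative D) (at x within S)"
  shows "f z - f x < D * (z - x)"
proof -
  define m where "m = (x + z) / 2"
  \<comment> \<open>The segment is parametrized from \<open>x\<close>, so that the limit at 0 is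
    one-sided in the same way whether \<open>z\<close> lies to the left or to the right.\<close>
  define h where "h u = (1 - u) * x + u * m" for u
  have conv: "convex S"
    using f by (simp add: strictly_concave_on_def)
  have m: "m \<in> S" "x \<noteq> m"
    using convexD[OF conv x z(1), of "1 / 2" "1 / 2"] z(2) by (auto simp: m_def field_simps)
  have fm: "(f x + f z) / 2 < f m"
  proof -
    have "(1 - 1 / 2) * f x + 1 / 2 * f z < f ((1 - 1 / 2) * x + 1 / 2 * z)"
      using f x z unfolding strictly_concave_on_def
      by (elim conjE ballE[of _ _ x] ballE[of _ _ z] allE[of _ "1 / 2"]) simp_all
    then show ?thesis by (simp add: m_def field_simps)
  qed
  have h: "h ` {0..1} \<subseteq> S"
    using convexD[OF conv x m(1)] by (auto simp: h_def)
  have "(h has_real_derivative m - x) (at 0 within {0..1})"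
    unfolding h_def[abs_def] by (auto intro!: derivative_eq_intros)
  moreover have "(f has_real_derivative D) (at (h 0) within h ` {0..1})"
    using DERIV_subset[OF D h] by (simp add: h_def)
  ultimately have "((\<lambda>u. f (h u)) has_real_derivative D * (m - x)) (at 0 within {0..1})"
    using DERIV_image_chain[of f D h 0 "{0..1}" "m - x"] by (simp add: o_def)
  then have "((\<lambda>u. (f (h u) - f x) / u) \<longlongrightarrow> D * (m - x)) (at 0 within {0..1})"
    by (simp add: has_field_derivative_iff h_def)
  moreover have "\<forall>\<^sub>F u in at 0 within {0..1::real}. f m - f x \<le> (f (h u) - f x) / u"
    unfolding eventually_at_filter
  proof (intro always_eventually allI impI)
    fix u :: real assume u: "u \<noteq> 0" "u \<in> {0..1}"
    have "(1 - u) * f x + u * f m \<le> f (h u)"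
    proof (cases "u = 1")
      case False
      then show ?thesis
        using f x m u unfolding strictly_concave_on_def h_def by (intro less_imp_le) auto
    qed (simp add: h_def)
    then show "f m - f x \<le> (f (h u) - f x) / u"
      using u by (simp add: field_simps)
  qed
  moreover have "at 0 within {0..1::real} \<noteq> bot"
    by (simp add: at_within_Icc_at_right)
  ultimately have "f m - f x \<le> D * (m - x)"
    by (intro tendsto_lowerbound)
  with fm show ?thesis
    by (simp add: m_def field_simps)
qed

lemma strictly_concave_on_ex1_arg_max:
  assumes f: "strictly_concave_on S f" and S: "compact S" "S \<noteq> {}" "continuous_on S f"
  shows "\<exists>!x. is_arg_max f (\<lambda>x. x \<in> S) x"
proof -
  obtain x where x: "x \<in> S" "\<And>y. y \<in> S \<Longrightarrow> f y \<le> f x"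
    using continuous_attains_sup[OF S] by blast
  show ?thesis
  proof (rule ex1I[of _ x])
    show "is_arg_max f (\<lambda>x. x \<in> S) x"
      using x by (auto simp: is_arg_max_linorder)
    fix y assume y: "is_arg_max f (\<lambda>x. x \<in> S) y"
    show "y = x"
    proof (rule ccontr)
      assume "y \<noteq> x"
      \<comment> \<open>The midpoint of two distinct maximizers would have a larger value.\<close>
      let ?m = "(1 - 1 / 2) * x + 1 / 2 * y"
      have yS: "y \<in> S" and fy: "f y = f x"
        using x y by (auto simp: is_arg_max_linorder intro: antisym)
      have *: "x \<noteq> y \<and> (0::real) < 1 / 2 \<and> (1::real) / 2 < 1"
        using \<open>y \<noteq> x\<close> by auto
      have "(1 - 1 / 2) * f x + 1 / 2 * f y < f ?m"
        using f x(1) yS * unfolding strictly_concave_on_def by blast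
      moreover have "?m \<in> S"
        using f x(1) yS convexD[of S x y "1 - 1 / 2" "1 / 2"] by (simp add: strictly_concave_on_def)
      ultimately show False
        using x(2)[of ?m] fy by simp
    qed
  qed
qed

lemma arg_max_interior_deriv_zero:
  fixes f :: "real \<Rightarrow> real"
  assumes "x \<in> interior S" "is_arg_max f (\<lambda>x. x \<in> S) x" "(f has_real_derivative D) (at x)"
  shows "D = 0"
proof -
  obtain e where "0 < e" "ball x e \<subseteq> S"
    using assms(1) by (auto simp: mem_interior)
  then show ?thesis
    using assms(2) by (intro DERIV_local_max[OF assms(3), of e])
      (auto simp: is_arg_max_linorder dist_real_def subset_iff)
qed

text \<open>An interior maximizer is compared with the tangents at both ends: maximality gives only
  a nonnegative increment, and the strict tangent inequality makes the slope signs strict.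
  Conversely, such slopes let \<open>f\<close> increase from either end into the interval, which
  excludes both ends as maximizers.\<close>

lemma strictly_concave_on_arg_max_interior_iff:
  assumes f: "strictly_concave_on {a..b} f"
    and f': "\<And>x. x \<in> {a..b} \<Longrightarrow> (f has_real_derivative f' x) (at x within {a..b})"
    and x: "is_arg_max f (\<lambda>x. x \<in> {a..b}) x"
  shows "x \<in> interior {a..b} \<longleftrightarrow> 0 < f' a \<and> f' b < 0"
proof
  have xab: "x \<in> {a..b}" and max: "\<And>y. y \<in> {a..b} \<Longrightarrow> f y \<le> f x"
    using x by (auto simp: is_arg_max_linorder)
  {
    assume int: "x \<in> interior {a..b}"
    then have "a < x" "x < b" by auto
    with strictly_concave_on_tangent[OF f _ xab _ f', of a]
      strictly_concave_on_tangent[OF f _ xab _ f', of b]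
    have "f x - f a < f' a * (x - a)" "f x - f b < f' b * (x - b)" by auto
    with max[of a] max[of b] \<open>a < x\<close> \<open>x < b\<close> have "0 < f' a * (x - a)" "0 < f' b * (x - b)"
      by auto
    with \<open>a < x\<close> \<open>x < b\<close> show "0 < f' a \<and> f' b < 0"
      by (simp add: zero_less_mult_iff)
  next
    assume *: "0 < f' a \<and> f' b < 0"
    \<comment> \<open>On a one-point interval the two sign conditions would contradict each
      other.\<close>
    then have "a < b"
      using xab by (cases "a = b") auto
    have "x \<noteq> a"
    proof
      assume "x = a"
      obtain d where "0 < d" "\<And>h. 0 < h \<Longrightarrow> a + h \<in> {a..b} \<Longrightarrow> h < d \<Longrightarrow> f a < f (a + h)"
        using has_real_derivative_pos_inc_right[OF f'[of a]] * \<open>a < b\<close> by auto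
      \<comment> \<open>\<open>d / 2\<close> stays within the range of strict increase, and
        \<open>b - a\<close> keeps the comparison point in the interval.\<close>
      moreover define h where "h = min (d / 2) (b - a)"
      ultimately have "0 < h" "h < d" "a + h \<in> {a..b}" "f a < f (a + h)"
        using \<open>a < b\<close> by (auto simp: min_less_iff_disj)
      then show False
        using max[of "a + h"] \<open>x = a\<close> by simp
    qed
    moreover have "x \<noteq> b"
    proof
      assume "x = b"
      obtain d where "0 < d" "\<And>h. 0 < h \<Longrightarrow> b - h \<in> {a..b} \<Longrightarrow> h < d \<Longrightarrow> f b < f (b - h)"
        using has_real_derivative_neg_dec_left[OF f'[of b]] * \<open>a < b\<close> by auto
      moreover define h where "h = min (d / 2) (b - a)"
      ultimately have "0 < h" "h < d" "b - h \<in> {a..b}" "f b < f (b - h)"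
        using \<open>a < b\<close> by (auto simp: min_less_iff_disj)
      then show False
        using max[of "b - h"] \<open>x = b\<close> by simp
    qed
    ultimately show "x \<in> interior {a..b}"
      using xab by auto
  }
qed

section \<open>Reduction of the HJB equation and optimal liquidity provision\<close>

theorem theorem6p5:
  fixes L :: "'a lp_model" and t :: real and \<omega> :: 'a
  assumes model: "lp_model_axioms L"
    and t: "0 < t" and \<omega>: "\<omega> \<in> space (pspace L)"
  shows
    "let \<eta> = eta L; y = variance L t \<omega>;
         \<Theta> = Theta_adm L t \<omega>; \<Phi> = Phi L t \<omega>; \<Phi>' = Phi_prime L t \<omega>;
         V = value_function L
     in
      \<comment> \<open>the value function has CRRA form, so that the HJB equation is the CRRA one\<close>
      (\<forall>w>0. V w = ereal (w powr (1 - \<eta>)) * V 1) \<and>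
      (V 1 \<noteq> 0 \<and> \<bar>V 1\<bar> \<noteq> \<infinity> \<longrightarrow>
         (\<exists>A>0. \<forall>w>0. V w = ereal (crra_value \<eta> (\<lambda>_. A) w y)) \<and>
         (\<forall>w>0. \<forall>\<theta>.
            is_arg_max (hjb_objective L (\<lambda>w y. real_of_ereal (V w)) t \<omega> w) (\<lambda>\<theta>. \<theta> \<in> \<Theta>) \<theta> \<longleftrightarrow>
            is_arg_max \<Phi> (\<lambda>\<theta>. \<theta> \<in> \<Theta>) \<theta>)) \<and>
      \<comment> \<open>reduction of the maximization in the CRRA HJB equation, also for variance-dependent coefficient\<close>
      (\<forall>f S. open S \<and> y \<in> S \<and> (\<forall>x\<in>S. 0 < f x) \<and> C2_on S f \<longrightarrow>
        (\<forall>w>0.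
          let U = crra_value \<eta> f;
              c = f y * w powr (1 - \<eta>);
              a = w powr (1 - \<eta>) / (1 - \<eta>) *
                  (1 + kappa L * (vbar L - y) * deriv f y + 1 / 2 * (xi L)\<^sup>2 * y * (deriv ^^ 2) f y)
          in 0 < c \<and>
             (\<forall>\<theta>\<in>\<Theta>. hjb_objective L U t \<omega> w \<theta> = a + c * \<Phi> \<theta>) \<and>
             (\<forall>\<theta>. is_arg_max (hjb_objective L U t \<omega> w) (\<lambda>\<theta>. \<theta> \<in> \<Theta>) \<theta> \<longleftrightarrow>
                   is_arg_max \<Phi> (\<lambda>\<theta>. \<theta> \<in> \<Theta>) \<theta>) \<and>
             (hjb_equation L U t \<omega> w \<longleftrightarrow>
                ereal (rho L * U w y) = ereal a + ereal c * (SUP \<theta>\<in>\<Theta>. ereal (\<Phi> \<theta>))))) \<and>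
      (assumption_A1 L t \<omega> \<and> assumption_A2 L t \<omega> \<and> assumption_A3 L t \<omega> \<longrightarrow>
         \<comment> \<open>(i)\<close>
         (\<exists>!\<theta>. is_arg_max \<Phi> (\<lambda>\<theta>. \<theta> \<in> \<Theta>) \<theta>) \<and>
         \<comment> \<open>(ii)\<close>
         (\<forall>\<theta>\<in>interior \<Theta>. (\<Phi> has_real_derivative \<Phi>' \<theta>) (at \<theta>)) \<and>
         (\<forall>\<theta>\<in>interior \<Theta>. is_arg_max \<Phi> (\<lambda>\<theta>. \<theta> \<in> \<Theta>) \<theta> \<longrightarrow> \<Phi>' \<theta> = 0) \<and>
         \<comment> \<open>(iii), at the end points of the admissible interval, where \<open>\<Phi>'\<close> is the one-sided derivative\<close>
         \<Theta> = {Inf \<Theta>..Sup \<Theta>} \<and>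
         (\<forall>\<theta>\<in>\<Theta>. (\<Phi> has_real_derivative \<Phi>' \<theta>) (at \<theta> within \<Theta>)) \<and>
         (\<forall>\<theta>. is_arg_max \<Phi> (\<lambda>\<theta>. \<theta> \<in> \<Theta>) \<theta> \<longrightarrow>
            (\<theta> \<in> interior \<Theta> \<longleftrightarrow> 0 < \<Phi>' (Inf \<Theta>) \<and> \<Phi>' (Sup \<Theta>) < 0)) \<and>
         \<comment> \<open>in particular, when the control bounds themselves are admissible\<close>
         (theta_min L \<in> \<Theta> \<and> theta_max L \<in> \<Theta> \<longrightarrow>
            (\<forall>\<theta>. is_arg_max \<Phi> (\<lambda>\<theta>. \<theta> \<in> \<Theta>) \<theta> \<longrightarrow>
              (\<theta> \<in> interior \<Theta> \<longleftrightarrow> 0 < \<Phi>' (theta_min L) \<and> \<Phi>' (theta_max L) < 0))))"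
proof -
  let ?\<eta> = "eta L" and ?y = "variance L t \<omega>" and ?\<Theta> = "Theta_adm L t \<omega>" and ?V = "value_function L"
  let ?\<Phi> = "Phi L t \<omega>" and ?\<Phi>' = "Phi_prime L t \<omega>"
  \<comment> \<open>\<open>c\<close> is the common factor of the terms that contain the control;
    \<open>a\<close> collects the flow utility and the variance part of the generator.\<close>
  define c where "c f w = f ?y * w powr (1 - ?\<eta>)" for f :: "real \<Rightarrow> real" and w
  define a where "a f w = w powr (1 - ?\<eta>) / (1 - ?\<eta>) *
      (1 + kappa L * (vbar L - ?y) * deriv f ?y + 1 / 2 * (xi L)\<^sup>2 * ?y * (deriv ^^ 2) f ?y)"
    for f :: "real \<Rightarrow> real" and w
  have scale: "?V w = ereal (w powr (1 - ?\<eta>)) * ?V 1" if "0 < w" for w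
    using value_function_scale[OF model that, of 1] by simp
  have crra: "\<exists>A>0. \<forall>w>0. ?V w = ereal (crra_value ?\<eta> (\<lambda>_. A) w ?y)"
    and crra_arg_max: "\<And>w \<theta>. 0 < w \<Longrightarrow>
      is_arg_max (hjb_objective L (\<lambda>w y. real_of_ereal (?V w)) t \<omega> w) (\<lambda>\<theta>. \<theta> \<in> ?\<Theta>) \<theta> \<longleftrightarrow>
      is_arg_max ?\<Phi> (\<lambda>\<theta>. \<theta> \<in> ?\<Theta>) \<theta>"
    if V: "?V 1 \<noteq> 0" "\<bar>?V 1\<bar> \<noteq> \<infinity>"
  proof -
    obtain A where A: "0 < A" "\<And>w y. 0 < w \<Longrightarrow> ?V w = ereal (crra_value ?\<eta> (\<lambda>_. A) w y)"
      using value_function_crra[OF model V] by metis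
    then show "\<exists>A>0. \<forall>w>0. ?V w = ereal (crra_value ?\<eta> (\<lambda>_. A) w ?y)"
      by blast
    \<comment> \<open>The value function is the case of a constant coefficient, with the whole line
      as the open set of variances.\<close>
    have C2: "C2_on UNIV (\<lambda>_. A)"
      unfolding C2_on_def by (intro exI[of _ "\<lambda>_. 0"]) auto
    have V_eq: "real_of_ereal (?V x) = crra_value ?\<eta> (\<lambda>_. A) x z" if "0 < x" for x z
      using A(2)[OF that, of z] by simp
    fix w \<theta> :: real assume w: "0 < w"
    show "is_arg_max (hjb_objective L (\<lambda>w y. real_of_ereal (?V w)) t \<omega> w) (\<lambda>\<theta>. \<theta> \<in> ?\<Theta>) \<theta> \<longleftrightarrow>
        is_arg_max ?\<Phi> (\<lambda>\<theta>. \<theta> \<in> ?\<Theta>) \<theta>"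
    proof (rule is_arg_max_affine)
      show "0 < A * w powr (1 - ?\<eta>)"
        using A(1) w by simp
      show "hjb_objective L (\<lambda>w y. real_of_ereal (?V w)) t \<omega> w \<theta> =
          a (\<lambda>_. A) w + A * w powr (1 - ?\<eta>) * ?\<Phi> \<theta>" if "\<theta> \<in> ?\<Theta>" for \<theta>
        unfolding a_def
        by (rule hjb_objective_crra[OF model t \<omega> open_UNIV UNIV_I C2 w V_eq
              borel_measurable_value_function[OF model] that])
    qed
  qed
  have reduction: "0 < c f w \<and>
      (\<forall>\<theta>\<in>?\<Theta>. hjb_objective L (crra_value ?\<eta> f) t \<omega> w \<theta> = a f w + c f w * ?\<Phi> \<theta>) \<and>
      (\<forall>\<theta>. is_arg_max (hjb_objective L (crra_value ?\<eta> f) t \<omega> w) (\<lambda>\<theta>. \<theta> \<in> ?\<Theta>) \<theta> \<longleftrightarrow>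
         is_arg_max ?\<Phi> (\<lambda>\<theta>. \<theta> \<in> ?\<Theta>) \<theta>) \<and>
      (hjb_equation L (crra_value ?\<eta> f) t \<omega> w \<longleftrightarrow>
         ereal (rho L * crra_value ?\<eta> f w ?y) = ereal (a f w) + ereal (c f w) * (SUP \<theta>\<in>?\<Theta>. ereal (?\<Phi> \<theta>)))"
    if f: "open S \<and> ?y \<in> S \<and> (\<forall>x\<in>S. 0 < f x) \<and> C2_on S f" and w: "0 < w" for f S w
  proof -
    have pos: "0 < c f w"
      using f w by (simp add: c_def)
    have obj: "hjb_objective L (crra_value ?\<eta> f) t \<omega> w \<theta> = a f w + c f w * ?\<Phi> \<theta>" if "\<theta> \<in> ?\<Theta>" for \<theta>
      unfolding a_def c_def using f that
      by (intro hjb_objective_crra[OF model t \<omega> _ _ _ w, of S]) (auto simp: crra_value_def)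
    then have "(SUP \<theta>\<in>?\<Theta>. ereal (hjb_objective L (crra_value ?\<eta> f) t \<omega> w \<theta>)) =
        (SUP \<theta>\<in>?\<Theta>. ereal (a f w + c f w * ?\<Phi> \<theta>))"
      by simp
    then show ?thesis
      using pos obj is_arg_max_affine[where P = "\<lambda>\<theta>. \<theta> \<in> ?\<Theta>", OF pos obj]
      by (simp add: hjb_equation_def SUP_ereal_affine)
  qed
  have optimum: "(\<exists>!\<theta>. is_arg_max ?\<Phi> (\<lambda>\<theta>. \<theta> \<in> ?\<Theta>) \<theta>) \<and>
      (\<forall>\<theta>\<in>interior ?\<Theta>. (?\<Phi> has_real_derivative ?\<Phi>' \<theta>) (at \<theta>)) \<and>
      (\<forall>\<theta>\<in>interior ?\<Theta>. is_arg_max ?\<Phi> (\<lambda>\<theta>. \<theta> \<in> ?\<Theta>) \<theta> \<longrightarrow> ?\<Phi>' \<theta> = 0) \<and>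
      ?\<Theta> = {Inf ?\<Theta>..Sup ?\<Theta>} \<and>
      (\<forall>\<theta>\<in>?\<Theta>. (?\<Phi> has_real_derivative ?\<Phi>' \<theta>) (at \<theta> within ?\<Theta>)) \<and>
      (\<forall>\<theta>. is_arg_max ?\<Phi> (\<lambda>\<theta>. \<theta> \<in> ?\<Theta>) \<theta> \<longrightarrow>
         (\<theta> \<in> interior ?\<Theta> \<longleftrightarrow> 0 < ?\<Phi>' (Inf ?\<Theta>) \<and> ?\<Phi>' (Sup ?\<Theta>) < 0)) \<and>
      (theta_min L \<in> ?\<Theta> \<and> theta_max L \<in> ?\<Theta> \<longrightarrow>
         (\<forall>\<theta>. is_arg_max ?\<Phi> (\<lambda>\<theta>. \<theta> \<in> ?\<Theta>) \<theta> \<longrightarrow>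
           (\<theta> \<in> interior ?\<Theta> \<longleftrightarrow> 0 < ?\<Phi>' (theta_min L) \<and> ?\<Phi>' (theta_max L) < 0)))"
    if A: "assumption_A1 L t \<omega> \<and> assumption_A2 L t \<omega> \<and> assumption_A3 L t \<omega>"
  proof -
    have ne: "?\<Theta> \<noteq> {}" and cpt: "compact ?\<Theta>" and conc: "strictly_concave_on ?\<Theta> ?\<Phi>"
      using A by (auto simp: assumption_A1_def assumption_A3_def)
    have D: "(?\<Phi> has_real_derivative ?\<Phi>' \<theta>) (at \<theta> within ?\<Theta>)" if "\<theta> \<in> ?\<Theta>" for \<theta>
      using Phi_has_derivative[OF model _ that] A by blast
    have "continuous_on ?\<Theta> ?\<Phi>"
      using D by (rule DERIV_continuous_on)
    then have ex1: "\<exists>!\<theta>. is_arg_max ?\<Phi> (\<lambda>\<theta>. \<theta> \<in> ?\<Theta>) \<theta>"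
      by (rule strictly_concave_on_ex1_arg_max[OF conc cpt ne])
    have Dint: "(?\<Phi> has_real_derivative ?\<Phi>' \<theta>) (at \<theta>)" if "\<theta> \<in> interior ?\<Theta>" for \<theta>
      using D[of \<theta>] that interior_subset at_within_interior[OF that] by auto
    \<comment> \<open>Convexity is part of \<open>strictly_concave_on\<close>, and a compact
      connected subset of the line is a closed interval.\<close>
    obtain l u where lu: "?\<Theta> = {l..u}"
      using cpt conc connected_compact_interval_1[of ?\<Theta>]
      by (auto simp: strictly_concave_on_def convex_connected)
    then have "l \<le> u"
      using ne by simp
    then have ends: "Inf ?\<Theta> = l" "Sup ?\<Theta> = u"
      by (simp_all add: lu)
    have iff: "\<theta> \<in> interior ?\<Theta> \<longleftrightarrow> 0 < ?\<Phi>' l \<and> ?\<Phi>' u < 0" if "is_arg_max ?\<Phi> (\<lambda>\<theta>. \<theta> \<in> ?\<Theta>) \<theta>" for \<theta>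
      using strictly_concave_on_arg_max_interior_iff[of l u ?\<Phi> ?\<Phi>' \<theta>] conc D that unfolding lu by blast
    have zero: "?\<Phi>' \<theta> = 0" if "\<theta> \<in> interior ?\<Theta>" "is_arg_max ?\<Phi> (\<lambda>\<theta>. \<theta> \<in> ?\<Theta>) \<theta>" for \<theta>
      using that Dint[OF that(1)] by (rule arg_max_interior_deriv_zero)
    have "?\<Theta> \<subseteq> {theta_min L..theta_max L}"
      by (auto simp: Theta_adm_def)
    \<comment> \<open>The admissible set lies between the control bounds, so bounds that belong to
      it are its end points.\<close>
    then have bounds: "theta_min L = l \<and> theta_max L = u" if "theta_min L \<in> ?\<Theta>" "theta_max L \<in> ?\<Theta>"
      using that \<open>l \<le> u\<close> unfolding lu by auto
    show ?thesis
      unfolding ends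
    proof (intro conjI allI ballI impI)
      fix \<theta>
      assume "theta_min L \<in> ?\<Theta> \<and> theta_max L \<in> ?\<Theta>" "is_arg_max ?\<Phi> (\<lambda>\<theta>. \<theta> \<in> ?\<Theta>) \<theta>"
      then show "\<theta> \<in> interior ?\<Theta> \<longleftrightarrow> 0 < ?\<Phi>' (theta_min L) \<and> ?\<Phi>' (theta_max L) < 0"
        using iff bounds by metis
    qed (fact ex1 lu | rule Dint zero D iff; assumption)+
  qed
  show ?thesis
    unfolding Let_def a_def[symmetric] c_def[symmetric]
  proof (rule conjI[OF _ conjI[OF _ conjI]], goal_cases)
    case 1
    show ?case using scale by (intro allI impI)
  next
    case 2
    show ?case by (intro impI conjI crra allI crra_arg_max; elim conjE)
  next
    case 3
    show ?case by (intro allI impI reduction)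
  next
    case 4
    show ?case by (intro impI optimum)
  qed
qed

end
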